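(* There is an algorithm that, given two related strings $A$ and $B$ of length $n$ over an alphabet $\Sigma$ and an integer $k$, decides whether there exists a mapping of $A$ into $B$ that preserves at least $k$ duos (i.e., solves the Maximum-Duo Preservation String Mapping problem on instance $(A,B,k)$) in time $2^{O(k)}\cdot O(\mathrm{poly}(n)\log n)$.
   Context: For a string $S$, $S[i]$ denotes its $i$-th symbol. A duo of $S$ is an ordered pair of consecutive symbols $(S[i],S[i+1])$, $1\le i\le |S|-1$; we say position $i$ induces this duo. Two strings $A$ and $B$ are related if $B$ is a permutation of $A$ (so $|A|=|B|=n$). A mapping of $A$ into $B$ is a bijection $m$ from the positions of $A$ to the positions of $B$ such that $m(i)=j$ implies $A[i]=B[j]$. A duo $(A[i],A[i+1])$ is preserved by $m$ if $m(i)=j$ and $m(i+1)=j+1$ for some $j$. The Maximum-Duo Preservation String Mapping problem (Max-Duo PSM): given related strings $A,B$ and an integer $k$, decide whether there is a mapping of $A$ into $B$ preserving at least $k$ duos. *)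

theory Defs
  imports
    Complex_Main
    "HOL-Library.Multiset"
    "HOL-Library.Landau_Symbols"
    "HOL-Computational_Algebra.Polynomial"
begin

section \<open>Maximum-Duo Preservation String Mapping\<close>

text \<open>Strings are lists and positions are counted from 0.\<close>

definition related :: "'a list \<Rightarrow> 'a list \<Rightarrow> bool" where
  "related A B \<longleftrightarrow> mset A = mset B"

definition is_mapping :: "'a list \<Rightarrow> 'a list \<Rightarrow> (nat \<Rightarrow> nat) \<Rightarrow> bool" where
  "is_mapping A B m \<longleftrightarrow>
     bij_betw m {..<length A} {..<length B} \<and> (\<forall>i<length A. A ! i = B ! m i)"

text \<open>
  A duo is identified with the position inducing it, so that equal pairs of symbols at
  different positions are counted separately.
\<close>

definition preserved_duos :: "'a list \<Rightarrow> (nat \<Rightarrow> nat) \<Rightarrow> nat set" where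
  "preserved_duos A m = {i. i + 1 < length A \<and> (\<exists>j. m i = j \<and> m (i + 1) = j + 1)}"

definition max_duo_psm :: "'a list \<Rightarrow> 'a list \<Rightarrow> nat \<Rightarrow> bool" where
  "max_duo_psm A B k \<longleftrightarrow> (\<exists>m. is_mapping A B m \<and> k \<le> card (preserved_duos A m))"


section \<open>Algorithms and their running time\<close>

text \<open>
  The machine model is the unit-cost RAM with addition and truncated subtraction, programmed in
  a while language. The memory consists of arrays of natural numbers addressed by computed
  indices; a program mentions only finitely many array names, and these are fixed in the program
  text. A scalar variable is cell 0 of an array. Multiplication is deliberately not a unit-cost
  operation: without it, values have at most linearly many bits more after \<open>t\<close> steps than they
  had in the input, so that unit-cost time is polynomially related to Turing machine time.
\<close>

type_synonym memory = "string \<Rightarrow> nat \<Rightarrow> nat"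

datatype aexp =
    Const nat
  | Cell string aexp
  | Plus aexp aexp
  | Minus aexp aexp

datatype bexp =
    Less aexp aexp
  | Equal aexp aexp
  | Not bexp
  | And bexp bexp

datatype com =
    Skip
  | Assign string aexp aexp  \<comment> \<open>array, index, value\<close>
  | Seq com com
  | Cond bexp com com
  | While bexp com

primrec aval :: "aexp \<Rightarrow> memory \<Rightarrow> nat" where
  "aval (Const c) s = c"
| "aval (Cell x a) s = s x (aval a s)"
| "aval (Plus a1 a2) s = aval a1 s + aval a2 s"
| "aval (Minus a1 a2) s = aval a1 s - aval a2 s"

primrec bval :: "bexp \<Rightarrow> memory \<Rightarrow> bool" where
  "bval (Less a1 a2) s \<longleftrightarrow> aval a1 s < aval a2 s"
| "bval (Equal a1 a2) s \<longleftrightarrow> aval a1 s = aval a2 s"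
| "bval (Not b) s \<longleftrightarrow> \<not> bval b s"
| "bval (And b1 b2) s \<longleftrightarrow> bval b1 s \<and> bval b2 s"

primrec acost :: "aexp \<Rightarrow> nat" where
  "acost (Const c) = 1"
| "acost (Cell x a) = 1 + acost a"
| "acost (Plus a1 a2) = 1 + acost a1 + acost a2"
| "acost (Minus a1 a2) = 1 + acost a1 + acost a2"

primrec bcost :: "bexp \<Rightarrow> nat" where
  "bcost (Less a1 a2) = 1 + acost a1 + acost a2"
| "bcost (Equal a1 a2) = 1 + acost a1 + acost a2"
| "bcost (Not b) = 1 + bcost b"
| "bcost (And b1 b2) = 1 + bcost b1 + bcost b2"

text \<open>
  \<open>exec c s t s'\<close>: program \<open>c\<close> started in memory \<open>s\<close> halts in memory \<open>s'\<close> after exactly \<open>t\<close>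
  elementary steps.
\<close>

inductive exec :: "com \<Rightarrow> memory \<Rightarrow> nat \<Rightarrow> memory \<Rightarrow> bool" where
  Skip: "exec Skip s 1 s"
| Assign: "exec (Assign x a e) s (1 + acost a + acost e)
     (s(x := (s x)(aval a s := aval e s)))"
| Seq: "\<lbrakk>exec c1 s1 t1 s2; exec c2 s2 t2 s3\<rbrakk> \<Longrightarrow> exec (Seq c1 c2) s1 (t1 + t2) s3"
| CondTrue: "\<lbrakk>bval b s; exec c1 s t s'\<rbrakk> \<Longrightarrow> exec (Cond b c1 c2) s (1 + bcost b + t) s'"
| CondFalse: "\<lbrakk>\<not> bval b s; exec c2 s t s'\<rbrakk> \<Longrightarrow> exec (Cond b c1 c2) s (1 + bcost b + t) s'"
| WhileFalse: "\<not> bval b s \<Longrightarrow> exec (While b c) s (1 + bcost b) s"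
| WhileTrue: "\<lbrakk>bval b s1; exec c s1 t1 s2; exec (While b c) s2 t2 s3\<rbrakk>
     \<Longrightarrow> exec (While b c) s1 (1 + bcost b + t1 + t2) s3"

lemma exec_deterministic:
  "exec c s t s' \<Longrightarrow> exec c s u s'' \<Longrightarrow> u = t \<and> s'' = s'"
proof (induction arbitrary: u s'' rule: exec.induct)
  case (Skip s)
  then show ?case by cases auto
next
  case (Assign x a e s)
  then show ?case by cases auto
next
  case (Seq c1 s1 t1 s2 c2 t2 s3)
  from Seq.prems obtain v w r where
    "exec c1 s1 v r" "exec c2 r w s''" "u = v + w" by cases
  with Seq.IH(1)[of v r] Seq.IH(2)[of w s''] show ?case by simp
next
  case (CondTrue b s c1 t s' c2)
  from CondTrue.prems CondTrue.hyps(1) obtain v where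
    "exec c1 s v s''" "u = 1 + bcost b + v" by cases simp_all
  with CondTrue.IH[of v s''] show ?case by simp
next
  case (CondFalse b s c2 t s' c1)
  from CondFalse.prems CondFalse.hyps(1) obtain v where
    "exec c2 s v s''" "u = 1 + bcost b + v" by cases simp_all
  with CondFalse.IH[of v s''] show ?case by simp
next
  case (WhileFalse b s c)
  from WhileFalse.prems WhileFalse.hyps show ?case by cases simp_all
next
  case (WhileTrue b s1 c t1 s2 t2 s3)
  from WhileTrue.prems WhileTrue.hyps(1) obtain v w r where
    "exec c s1 v r" "exec (While b c) r w s''" "u = 1 + bcost b + v + w" by cases simp_all
  with WhileTrue.IH(1)[of v r] WhileTrue.IH(2)[of w s''] show ?case by simp
qed

text \<open>
  An instance is presented with the symbols of the alphabet coded as natural numbers. No bound on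
  the codes is imposed, so a program must cope with every alphabet.
\<close>

definition array_of :: "nat list \<Rightarrow> nat \<Rightarrow> nat" where
  "array_of xs i = (if i < length xs then xs ! i else 0)"

definition psm_input :: "nat list \<Rightarrow> nat list \<Rightarrow> nat \<Rightarrow> memory" where
  "psm_input A B k =
     (\<lambda>_ _. 0)(''A'' := array_of A, ''B'' := array_of B,
               ''n'' := array_of [length A], ''k'' := array_of [k])"

definition accepts :: "memory \<Rightarrow> bool" where
  "accepts s \<longleftrightarrow> s ''result'' 0 = 1"

end

theory Submission
  imports Defs
begin

text \<open>
  A mapping preserves \<open>k\<close> duos iff some partial label-preserving assignment of positions of \<open>A\<close> to
  \<open>d = min (2 * k) n\<close> distinct positions of \<open>B\<close> does, because \<open>k\<close> duos touch at most \<open>2 * k\<close>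
  positions and every partial mapping between related strings extends. Dynamic programming along
  \<open>A\<close> sums over all assignments, injective or not, and distinctness is enforced algebraically: every
  assignment with image \<open>u\<^sub>1, \<dots>, u\<^sub>d\<close> is weighted with the square of the Vandermonde determinant of
  \<open>2 ^ u\<^sub>1, \<dots>, 2 ^ u\<^sub>d\<close>, which vanishes exactly on repetitions. Since squares do not cancel, this
  needs no randomness. Laplace expansion of both factors turns the determinants into states \<open>(I, J)\<close>
  of sets of exponents that are already spent, \<open>4 ^ d\<close> in number. Every preserved duo contributes a
  further factor \<open>2 ^ L\<close>, with \<open>L\<close> so large that the total reaches \<open>2 ^ (L * k)\<close> iff a
  nonvanishing assignment preserves \<open>k\<close> duos. All factors are powers of two, so that multiplying
  by them is repeated addition.
\<close>

section \<open>A compiler for expressions with bounded sums\<close>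

datatype binop = Add | Sub | Mul | Div | Shl

text \<open>Division by repeated subtraction leaves the dividend when the divisor is 0.\<close>

fun binop_val :: "binop \<Rightarrow> nat \<Rightarrow> nat \<Rightarrow> nat" where
  "binop_val Add a b = a + b"
| "binop_val Sub a b = a - b"
| "binop_val Mul a b = a * b"
| "binop_val Div a b = (if b = 0 then a else a div b)"
| "binop_val Shl a b = a * 2 ^ b"

text \<open>The division loop runs as often as its dividend rather than its quotient, so that its
  length is known before it starts; addition and subtraction are primitive.\<close>

fun binop_iters :: "binop \<Rightarrow> nat \<Rightarrow> nat \<Rightarrow> nat" where
  "binop_iters Add a b = 0"
| "binop_iters Sub a b = 0"
| "binop_iters Mul a b = b"
| "binop_iters Div a b = a"
| "binop_iters Shl a b = b"

datatype tm =
    Num nat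
  | Arr string tm
  | Bin binop tm tm
  | Ite tm tm tm
  | Sum string tm tm

primrec eval :: "tm \<Rightarrow> memory \<Rightarrow> nat" where
  "eval (Num c) s = c"
| "eval (Arr x t) s = s x (eval t s)"
| "eval (Bin f t u) s = binop_val f (eval t s) (eval u s)"
| "eval (Ite t u v) s = (if eval t s = 0 then eval v s else eval u s)"
| "eval (Sum x t u) s = (\<Sum>v<eval t s. eval u (s(x := (s x)(0 := v))))"

text \<open>Only the values that control a loop are bounded by \<open>W\<close>. Summands and the
  left operand of a shift stay unrestricted, because table entries can be far larger than any useful
  time bound.\<close>

primrec bounded_iters :: "nat \<Rightarrow> tm \<Rightarrow> memory \<Rightarrow> bool" where
  "bounded_iters W (Num c) s \<longleftrightarrow> True"
| "bounded_iters W (Arr x t) s \<longleftrightarrow> bounded_iters W t s"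
| "bounded_iters W (Bin f t u) s \<longleftrightarrow> bounded_iters W t s \<and> bounded_iters W u s \<and>
     binop_iters f (eval t s) (eval u s) \<le> W"
| "bounded_iters W (Ite t u v) s \<longleftrightarrow> bounded_iters W t s \<and>
     (if eval t s = 0 then bounded_iters W v s else bounded_iters W u s)"
| "bounded_iters W (Sum x t u) s \<longleftrightarrow> bounded_iters W t s \<and> eval t s \<le> W \<and>
     (\<forall>v<eval t s. bounded_iters W u (s(x := (s x)(0 := v))))"

abbreviation stack :: string where "stack \<equiv> ''stack''"

abbreviation cell :: "nat \<Rightarrow> aexp" where "cell p \<equiv> Cell stack (Const p)"

abbreviation set_cell :: "nat \<Rightarrow> aexp \<Rightarrow> com" where "set_cell p e \<equiv> Assign stack (Const p) e"

primrec stackless :: "tm \<Rightarrow> bool" where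
  "stackless (Num c) \<longleftrightarrow> True"
| "stackless (Arr x t) \<longleftrightarrow> x \<noteq> stack \<and> stackless t"
| "stackless (Bin f t u) \<longleftrightarrow> stackless t \<and> stackless u"
| "stackless (Ite t u v) \<longleftrightarrow> stackless t \<and> stackless u \<and> stackless v"
| "stackless (Sum x t u) \<longleftrightarrow> x \<noteq> stack \<and> stackless t \<and> stackless u"

definition with_stack :: "memory \<Rightarrow> (nat \<Rightarrow> nat) \<Rightarrow> memory" where
  "with_stack s f = s(stack := f)"

lemma with_stack_apply [simp]:
  "with_stack s f stack = f" "x \<noteq> stack \<Longrightarrow> with_stack s f x = s x"
  by (simp_all add: with_stack_def)

lemma with_stack_upd [simp]:
  "with_stack (with_stack s f) g = with_stack s g"
  "x \<noteq> stack \<Longrightarrow> (with_stack s f)(x := h) = with_stack (s(x := h)) f"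
  by (auto simp: with_stack_def)

lemma with_stack_inject [simp]: "with_stack s f = with_stack s g \<longleftrightarrow> f = g"
  using with_stack_apply(1) by metis

lemma with_stack_id [simp]: "with_stack s (s stack) = s"
  by (simp add: with_stack_def)

lemma eval_stack [simp]: "stackless t \<Longrightarrow> eval t (with_stack s f) = eval t s"
  by (induction t arbitrary: s) auto

lemma bounded_iters_stack [simp]:
  "stackless t \<Longrightarrow> bounded_iters W t (with_stack s f) = bounded_iters W t s"
  by (induction t arbitrary: s) auto

abbreviation count_loop :: "nat \<Rightarrow> nat \<Rightarrow> com \<Rightarrow> com" where
  "count_loop l b c \<equiv> Seq (set_cell l (Const 0))
     (While (Less (cell l) (cell b)) (Seq c (set_cell l (Plus (cell l) (Const 1)))))"

text \<open>The operands are in the stack cells \<open>p\<close> and \<open>p + 1\<close>; the value replaces the first one.\<close>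

primrec binop_code :: "binop \<Rightarrow> nat \<Rightarrow> com" where
  "binop_code Add p = set_cell p (Plus (cell p) (cell (p + 1)))"
| "binop_code Sub p = set_cell p (Minus (cell p) (cell (p + 1)))"
| "binop_code Mul p = Seq (set_cell (p + 3) (cell p)) (Seq (set_cell p (Const 0))
     (count_loop (p + 2) (p + 1) (set_cell p (Plus (cell p) (cell (p + 3))))))"
| "binop_code Div p = Seq (set_cell (p + 3) (cell p)) (Seq (set_cell (p + 4) (cell p)) (Seq
    (set_cell p (Const 0))
     (count_loop (p + 2) (p + 3)
        (Cond (Less (cell (p + 4)) (cell (p + 1))) Skip
          (Seq (set_cell (p + 4) (Minus (cell (p + 4)) (cell (p + 1))))
               (set_cell p (Plus (cell p) (Const 1))))))))"
| "binop_code Shl p = count_loop (p + 2) (p + 1) (set_cell p (Plus (cell p) (cell p)))"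

text \<open>Calling convention: the value ends up in stack cell \<open>p\<close>, cells below are
  kept, cells above are free. In a sum, \<open>p\<close> accumulates, \<open>p + 1\<close> holds the
  number of summands, \<open>p + 2\<close> the outer value of \<open>x\<close> and
  \<open>p + 3\<close> the counter.\<close>

primrec compile :: "tm \<Rightarrow> nat \<Rightarrow> com" where
  "compile (Num c) p = set_cell p (Const c)"
| "compile (Arr x t) p = Seq (compile t p) (set_cell p (Cell x (cell p)))"
| "compile (Bin f t u) p = Seq (compile t p) (Seq (compile u (p + 1)) (binop_code f p))"
| "compile (Ite t u v) p = Seq (compile t p)
     (Cond (Equal (cell p) (Const 0)) (compile v p) (compile u p))"
| "compile (Sum x t u) p = Seq (compile t (p + 1)) (Seq (set_cell (p + 2) (Cell x (Const 0)))
     (Seq (set_cell p (Const 0))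
     (Seq (count_loop (p + 3) (p + 1)
        (Seq (Assign x (Const 0) (cell (p + 3))) (Seq (compile u (p + 4))
          (set_cell p (Plus (cell p) (cell (p + 4)))))))
     (Assign x (Const 0) (cell (p + 2))))))"

section \<open>Time-bounded correctness statements for programs\<close>

definition runs :: "com \<Rightarrow> memory \<Rightarrow> nat \<Rightarrow> (memory \<Rightarrow> bool) \<Rightarrow> bool" where
  "runs c s T Q \<longleftrightarrow> (\<exists>t s'. exec c s t s' \<and> t \<le> T \<and> Q s')"

lemma runs_assign: "Q (s(x := (s x)(aval a s := aval e s))) \<Longrightarrow> 1 + acost a + acost e \<le> T
   \<Longrightarrow> runs (Assign x a e) s T Q"
  unfolding runs_def by (metis exec.Assign)

lemma runs_set_cell: "Q (with_stack s ((s stack)(p := aval e s))) \<Longrightarrow> 2 + acost e \<le> T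
   \<Longrightarrow> runs (set_cell p e) s T Q"
  by (rule runs_assign) (simp_all add: with_stack_def)

lemma runs_seq: "runs c1 s T1 (\<lambda>s'. runs c2 s' T2 Q) \<Longrightarrow> T1 + T2 \<le> T \<Longrightarrow> runs (Seq c1 c2) s T Q"
  unfolding runs_def by (metis (no_types, lifting) add_mono exec.Seq order_trans)

lemma runs_mono: "runs c s T Q \<Longrightarrow> T \<le> T' \<Longrightarrow> (\<And>s'. Q s' \<Longrightarrow> Q' s') \<Longrightarrow> runs c s T' Q'"
  unfolding runs_def by (meson order_trans)

lemma runs_skip: "Q s \<Longrightarrow> 1 \<le> T \<Longrightarrow> runs Skip s T Q"
  unfolding runs_def by (metis exec.Skip)

lemma runs_cond: "(bval b s \<Longrightarrow> runs c1 s T Q) \<Longrightarrow> (\<not> bval b s \<Longrightarrow> runs c2 s T Q)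
   \<Longrightarrow> 1 + bcost b + T \<le> T' \<Longrightarrow> runs (Cond b c1 c2) s T' Q"
proof (cases "bval b s")
  case True
  assume "bval b s \<Longrightarrow> runs c1 s T Q" "1 + bcost b + T \<le> T'"
  with True obtain t s' where "exec c1 s t s'" "t \<le> T" "Q s'" unfolding runs_def by blast
  with exec.CondTrue[OF True this(1)] \<open>1 + bcost b + T \<le> T'\<close> show ?thesis
    unfolding runs_def by (meson add_left_mono order_trans)
next
  case False
  assume "\<not> bval b s \<Longrightarrow> runs c2 s T Q" "1 + bcost b + T \<le> T'"
  with False obtain t s' where "exec c2 s t s'" "t \<le> T" "Q s'" unfolding runs_def by blast
  with exec.CondFalse[OF False this(1)] \<open>1 + bcost b + T \<le> T'\<close> show ?thesis
    unfolding runs_def by (meson add_left_mono order_trans)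
qed

lemma runs_while:
  assumes step: "\<And>i s. i < N \<Longrightarrow> Q i s \<Longrightarrow> runs c s T (Q (Suc i))"
    and test: "\<And>i s. i \<le> N \<Longrightarrow> Q i s \<Longrightarrow> bval b s \<longleftrightarrow> i < N"
    and init: "Q 0 s"
  shows "runs (While b c) s (N * (T + 1 + bcost b) + 1 + bcost b) (Q N)"
proof -
  \<comment> \<open>Induction on the number \<open>k\<close> of iterations still to come, with the
    invariant at index \<open>N - k\<close>.\<close>
  have "runs (While b c) s (k * (T + 1 + bcost b) + 1 + bcost b) (Q N)"
    if "k \<le> N" "Q (N - k) s" for k s
    using that
  proof (induction k arbitrary: s)
    case 0
    then have "\<not> bval b s" using test[of N s] by simp
    from exec.WhileFalse[OF this] 0 show ?case unfolding runs_def by auto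
  next
    case (Suc k)
    then have b: "bval b s" using test[of "N - Suc k" s] by simp
    have "runs c s T (Q (Suc (N - Suc k)))" using Suc.prems by (intro step) auto
    moreover have "Suc (N - Suc k) = N - k" using Suc.prems by simp
    ultimately obtain t1 s1 where 1: "exec c s t1 s1" "t1 \<le> T" "Q (N - k) s1"
      unfolding runs_def by auto
    from Suc.IH[OF _ 1(3)] Suc.prems obtain t2 s2 where
      2: "exec (While b c) s1 t2 s2" "t2 \<le> k * (T + 1 + bcost b) + 1 + bcost b" "Q N s2"
      unfolding runs_def by auto
    from exec.WhileTrue[OF b 1(1) 2(1)] 1(2) 2(2,3) show ?case
      unfolding runs_def by (intro exI[of _ "1 + bcost b + t1 + t2"] exI[of _ s2]) auto
  qed
  from this[of N s] init show ?thesis by simp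
qed

text \<open>Of the 12 steps added per iteration, 6 pay for incrementing the counter and 6 for the
  loop test; the final 9 are 3 for resetting the counter and 6 for the failing test.\<close>

lemma runs_count_loop:
  assumes step: "\<And>i s. i < N \<Longrightarrow> Q i s \<Longrightarrow>
      runs c s T (\<lambda>s'. Q (Suc i) (with_stack s' ((s' stack)(l := Suc (s' stack l)))))"
    and test: "\<And>i s. i \<le> N \<Longrightarrow> Q i s \<Longrightarrow> s stack l = i \<and> s stack b = N"
    and init: "Q 0 (with_stack s ((s stack)(l := 0)))"
    and fin: "\<And>s'. Q N s' \<Longrightarrow> R s'" and TT: "N * (T + 12) + 9 \<le> T'"
  shows "runs (count_loop l b c) s T' R"
proof -
  have "runs (While (Less (cell l) (cell b)) (Seq c (set_cell l (Plus (cell l) (Const 1)))))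
      (with_stack s ((s stack)(l := 0))) (N * ((T + 6) + 1 + bcost (Less (cell l) (cell b))) + 1
        + bcost (Less (cell l) (cell b))) (Q N)"
  proof (rule runs_while)
    fix i s assume "i < N" "Q i s"
    from step[OF this] show "runs (Seq c (set_cell l (Plus (cell l) (Const 1)))) s (T + 6) (Q (Suc i))"
      by (intro runs_seq[where ?T1.0 = T and ?T2.0 = 6])
        (auto elim!: runs_mono[OF _ order_refl] intro!: runs_set_cell)
  qed (use test init in auto)
  then show ?thesis using TT
    by (intro runs_seq[where ?T1.0 = 3 and ?T2.0 = "T' - 3"] runs_set_cell)
      (auto intro: fin elim!: runs_mono simp: algebra_simps)
qed

section \<open>Correctness of the compiled terms\<close>

definition leaves :: "memory \<Rightarrow> nat \<Rightarrow> nat \<Rightarrow> memory \<Rightarrow> bool" where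
  "leaves s p v s' \<longleftrightarrow> (\<exists>f. s' = with_stack s f \<and> f p = v \<and> (\<forall>q<p. f q = s stack q))"

lemma leaves_with_stack [simp]:
  "leaves s p v (with_stack s f) \<longleftrightarrow> f p = v \<and> (\<forall>q<p. f q = s stack q)"
  by (simp add: leaves_def)

lemma runs_binop_code:
  assumes "binop_iters f (s stack p) (s stack (p + 1)) \<le> W"
  shows "runs (binop_code f p) s (W * 40 + 40)
    (leaves s p (binop_val f (s stack p) (s stack (p + 1))))"
proof (cases f)
  case Add
  then show ?thesis by (auto intro!: runs_set_cell)
next
  case Sub
  then show ?thesis by (auto intro!: runs_set_cell)
next
  case Shl
  let ?Q = "\<lambda>i s'. \<exists>g. s' = with_stack s g \<and> g p = s stack p * 2 ^ i \<and> g (p + 1) = s stack (p + 1)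
     \<and> g (p + 2) = i \<and> (\<forall>q<p. g q = s stack q)"
  have "runs (count_loop (p + 2) (p + 1) (set_cell p (Plus (cell p) (cell p)))) s (W * 40 + 40)
     (leaves s p (s stack p * 2 ^ s stack (p + 1)))"
    by (rule runs_count_loop[where Q = ?Q and T = 7 and N = "s stack (p + 1)"])
      (use assms Shl in \<open>auto intro!: runs_set_cell\<close>)
  then show ?thesis by (simp add: Shl)
next
  case Mul
  let ?Q = "\<lambda>i s'. \<exists>g. s' = with_stack s g \<and> g p = s stack p * i \<and> g (p + 1) = s stack (p + 1)
     \<and> g (p + 2) = i \<and> g (p + 3) = s stack p \<and> (\<forall>q<p. g q = s stack q)"
  have "runs (binop_code Mul p) s (W * 40 + 40) (leaves s p (s stack p * s stack (p + 1)))"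
    unfolding binop_code.simps
    by (rule runs_seq[where ?T1.0 = 4 and ?T2.0 = "W * 40 + 36"], rule runs_set_cell,
        rule runs_seq[where ?T1.0 = 3 and ?T2.0 = "W * 40 + 33"], rule runs_set_cell,
        rule runs_count_loop[where Q = ?Q and T = 7 and N = "s stack (p + 1)"])
      (use assms Mul in \<open>auto intro!: runs_set_cell\<close>)
  then show ?thesis by (simp add: Mul)
next
  case Div
  let ?b = "s stack (p + 1)"
  \<comment> \<open>The cells \<open>p\<close> and \<open>p + 4\<close> hold quotient and remainder
    so far. Until the remainder drops below the divisor every iteration subtracts once, hence the
    alternative \<open>g p = i\<close>.\<close>
  let ?Q = "\<lambda>i s'. \<exists>g. s' = with_stack s g \<and> g (p + 1) = ?b \<and> g (p + 2) = i \<and> g (p + 3) = s stack p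
     \<and> s stack p = g p * ?b + g (p + 4) \<and> (g (p + 4) < ?b \<or> g p = i) \<and> (\<forall>q<p. g q = s stack q)"
  have fin: "leaves s p (binop_val Div (s stack p) ?b) s'" if "?Q (s stack p) s'" for s'
  proof -
    from that obtain g where g: "s' = with_stack s g" "s stack p = g p * ?b + g (p + 4)"
      "g (p + 4) < ?b \<or> g p = s stack p" "\<forall>q<p. g q = s stack q" by blast
    have "g p = (if ?b = 0 then s stack p else s stack p div ?b)"
    proof (cases "g (p + 4) < ?b")
      case True
      then show ?thesis by (auto simp: g(2))
    next
      case False
      with g(2,3) have eq: "s stack p = s stack p * ?b + g (p + 4)" "g p = s stack p" by auto
      show ?thesis
      proof (cases "?b = 0")
        case False
        \<comment> \<open>If each of the \<open>s stack p\<close> iterations subtracted a positive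
          divisor, nothing is left, contrary to a remainder of at least \<open>?b\<close>.\<close>
        then have "s stack p \<le> s stack p * ?b" by simp
        with eq(1) have "g (p + 4) = 0" by linarith
        with False \<open>\<not> g (p + 4) < ?b\<close> show ?thesis by simp
      qed (use eq in simp)
    qed
    then show ?thesis using g by simp
  qed
  have step: "runs (Cond (Less (cell (p + 4)) (cell (p + 1))) Skip
          (Seq (set_cell (p + 4) (Minus (cell (p + 4)) (cell (p + 1))))
               (set_cell p (Plus (cell p) (Const 1))))) s' 25
      (\<lambda>s'. ?Q (Suc i) (with_stack s' ((s' stack)(p + 2 := Suc (s' stack (p + 2))))))"
    if "?Q i s'" for i s'
  proof -
    from that obtain g where g: "s' = with_stack s g" "g (p + 1) = ?b" "g (p + 2) = i"
      "g (p + 3) = s stack p" "s stack p = g p * ?b + g (p + 4)"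
      "g (p + 4) < ?b \<or> g p = i" "\<forall>q<p. g q = s stack q" by blast
    show ?thesis
    proof (rule runs_cond[where T = 14])
      assume "bval (Less (cell (p + 4)) (cell (p + 1))) s'"
      then show "runs Skip s' 14
          (\<lambda>s'. ?Q (Suc i) (with_stack s' ((s' stack)(p + 2 := Suc (s' stack (p + 2))))))"
        using g by (intro runs_skip) auto
    next
      assume "\<not> bval (Less (cell (p + 4)) (cell (p + 1))) s'"
      then have "?b \<le> g (p + 4)" "g p = i" using g by auto
      then show "runs (Seq (set_cell (p + 4) (Minus (cell (p + 4)) (cell (p + 1))))
            (set_cell p (Plus (cell p) (Const 1)))) s' 14
          (\<lambda>s'. ?Q (Suc i) (with_stack s' ((s' stack)(p + 2 := Suc (s' stack (p + 2))))))"
        using g by (intro runs_seq[where ?T1.0 = 7 and ?T2.0 = 7] runs_set_cell) auto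
    qed simp
  qed
  have "runs (binop_code Div p) s (W * 40 + 40) (leaves s p (binop_val Div (s stack p) ?b))"
    unfolding binop_code.simps
    by (rule runs_seq[where ?T1.0 = 4 and ?T2.0 = "W * 40 + 36"], rule runs_set_cell,
        rule runs_seq[where ?T1.0 = 4 and ?T2.0 = "W * 40 + 32"], rule runs_set_cell,
        rule runs_seq[where ?T1.0 = 3 and ?T2.0 = "W * 40 + 29"], rule runs_set_cell,
        rule runs_count_loop[where Q = ?Q and T = 25 and N = "s stack p", OF step _ _ fin])
      (use assms Div in auto)
  then show ?thesis by (simp add: Div)
qed

primrec time_bound :: "nat \<Rightarrow> tm \<Rightarrow> nat" where
  "time_bound W (Num c) = 3"
| "time_bound W (Arr x t) = time_bound W t + 5"
| "time_bound W (Bin f t u) = time_bound W t + time_bound W u + W * 40 + 40"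
| "time_bound W (Ite t u v) = time_bound W t + time_bound W u + time_bound W v + 5"
| "time_bound W (Sum x t u) = time_bound W t + W * (time_bound W u + 30) + 30"

text \<open>Structural induction over all memories and offsets \<open>p\<close>. Subterms run at
  offsets above the partial results still needed, and since they avoid the stack, what is stored
  there does not affect their values.\<close>

theorem runs_compile:
  assumes "stackless t" "bounded_iters W t s"
  shows "runs (compile t p) s (time_bound W t) (leaves s p (eval t s))"
  using assms
proof (induction t arbitrary: s p)
  case (Num c)
  then show ?case by (auto intro!: runs_set_cell)
next
  case (Arr x t)
  then have "runs (compile t p) s (time_bound W t) (leaves s p (eval t s))" by simp
  moreover have "runs (set_cell p (Cell x (cell p))) s' 5 (leaves s p (s x (eval t s)))"
    if "leaves s p (eval t s) s'" for s'
    using that Arr.prems by (auto simp: leaves_def intro!: runs_set_cell)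
  ultimately show ?case
    by (auto intro!: runs_seq[where ?T1.0 = "time_bound W t" and ?T2.0 = 5] elim!: runs_mono)
next
  case (Bin f t u)
  then have 1: "runs (compile t p) s (time_bound W t) (leaves s p (eval t s))" by simp
  show ?case unfolding compile.simps
  proof (rule runs_seq[OF runs_mono[OF 1 order_refl], where ?T2.0 = "time_bound W u + W * 40 + 40"])
    fix s1 assume "leaves s p (eval t s) s1"
    then obtain g where g: "s1 = with_stack s g" "g p = eval t s" "\<forall>q<p. g q = s stack q"
      by (auto simp: leaves_def)
    have 2: "runs (compile u (p + 1)) s1 (time_bound W u) (leaves s1 (p + 1) (eval u s))"
      using Bin.IH(2)[of s1 "p + 1"] Bin.prems g(1) by simp
    show "runs (Seq (compile u (p + 1)) (binop_code f p)) s1 (time_bound W u + W * 40 + 40)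
        (leaves s p (eval (Bin f t u) s))"
    proof (rule runs_seq[OF runs_mono[OF 2 order_refl], where ?T2.0 = "W * 40 + 40"])
      fix s2 assume "leaves s1 (p + 1) (eval u s) s2"
      then obtain h where h: "s2 = with_stack s h" "h p = eval t s" "h (p + 1) = eval u s"
        "\<forall>q<p. h q = s stack q" using g by (auto simp: leaves_def)
      have "runs (binop_code f p) s2 (W * 40 + 40) (leaves s2 p (binop_val f (eval t s) (eval u s)))"
        using runs_binop_code[of f s2 p W] h Bin.prems by simp
      then show "runs (binop_code f p) s2 (W * 40 + 40) (leaves s p (eval (Bin f t u) s))"
        by (rule runs_mono) (use h in \<open>auto simp: leaves_def\<close>)
    qed simp
  qed simp
next
  case (Ite t u v)
  then have 1: "runs (compile t p) s (time_bound W t) (leaves s p (eval t s))" by simp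
  show ?case unfolding compile.simps
  proof (rule runs_seq[OF runs_mono[OF 1 order_refl], where ?T2.0 = "time_bound W u + time_bound W
      v + 5"])
    fix s1 assume "leaves s p (eval t s) s1"
    then obtain g where g: "s1 = with_stack s g" "g p = eval t s" "\<forall>q<p. g q = s stack q"
      by (auto simp: leaves_def)
    show "runs (Cond (Equal (cell p) (Const 0)) (compile v p) (compile u p)) s1
        (time_bound W u + time_bound W v + 5) (leaves s p (eval (Ite t u v) s))"
    proof (rule runs_cond[where T = "time_bound W u + time_bound W v"])
      assume "bval (Equal (cell p) (Const 0)) s1"
      then have z: "eval t s = 0" using g by simp
      then have "runs (compile v p) s1 (time_bound W v) (leaves s1 p (eval v s))"
        using Ite.IH(3)[of s1 p] Ite.prems g(1) by simp
      then show "runs (compile v p) s1 (time_bound W u + time_bound W v) (leaves s p (eval (Ite t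
          u v) s))"
        by (rule runs_mono) (use g z in \<open>auto simp: leaves_def\<close>)
    next
      assume "\<not> bval (Equal (cell p) (Const 0)) s1"
      then have z: "eval t s \<noteq> 0" using g by simp
      then have "runs (compile u p) s1 (time_bound W u) (leaves s1 p (eval u s))"
        using Ite.IH(2)[of s1 p] Ite.prems g(1) by simp
      then show "runs (compile u p) s1 (time_bound W u + time_bound W v) (leaves s p (eval (Ite t
          u v) s))"
        by (rule runs_mono) (use g z in \<open>auto simp: leaves_def\<close>)
    qed simp
  qed simp
next
  case (Sum x t u)
  let ?n = "eval t s" and ?c = "s x 0" and ?s = "\<lambda>v. s(x := (s x)(0 := v))"
  \<comment> \<open>The bound variable may hold any value \<open>v\<close>: before the first
    iteration it has its outer value \<open>?c\<close>, afterwards the index of the previous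
    summand.\<close>
  let ?Q = "\<lambda>i s'. \<exists>g v. s' = with_stack (?s v) g \<and> g p = (\<Sum>w<i. eval u (?s w))
      \<and> g (p + 1) = ?n \<and> g (p + 2) = ?c \<and> g (p + 3) = i \<and> (\<forall>q<p. g q = s stack q)"
  from Sum.prems have x [simp]: "x \<noteq> stack" "stack \<noteq> x" and n: "?n \<le> W" by auto
  from Sum have 1: "runs (compile t (p + 1)) s (time_bound W t) (leaves s (p + 1) ?n)" by simp
  let ?body = "Seq (Assign x (Const 0) (cell (p + 3))) (Seq (compile u (p + 4))
          (set_cell p (Plus (cell p) (cell (p + 4)))))"
  have body: "runs ?body s' (time_bound W u + 18)
       (\<lambda>s'. ?Q (Suc i) (with_stack s' ((s' stack)(p + 3 := Suc (s' stack (p + 3))))))"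
    if i: "i < ?n" and Q: "?Q i s'" for i s'
  proof -
    from Q obtain g v where g: "s' = with_stack (?s v) g"
      "g p = (\<Sum>w<i. eval u (?s w))" "g (p + 1) = ?n" "g (p + 2) = ?c" "g (p + 3) = i"
      "\<forall>q<p. g q = s stack q" by blast
    have 2: "runs (compile u (p + 4)) (with_stack (?s i) g) (time_bound W u)
        (leaves (with_stack (?s i) g) (p + 4) (eval u (?s i)))"
      using Sum.IH(2)[of "with_stack (?s i) g" "p + 4"] Sum.prems i by (simp del: fun_upd_apply)
    have "runs (Seq (compile u (p + 4)) (set_cell p (Plus (cell p) (cell (p + 4)))))
        (with_stack (?s i) g) (time_bound W u + 10)
        (\<lambda>s'. ?Q (Suc i) (with_stack s' ((s' stack)(p + 3 := Suc (s' stack (p + 3))))))"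
    proof (rule runs_seq[OF runs_mono[OF 2 order_refl], where ?T2.0 = 7])
      fix s2 assume "leaves (with_stack (?s i) g) (p + 4) (eval u (?s i)) s2"
      then obtain h where h: "s2 = with_stack (?s i) h" "h (p + 4) = eval u (?s i)"
        "\<forall>q<p + 4. h q = g q" by (auto simp: leaves_def)
      show "runs (set_cell p (Plus (cell p) (cell (p + 4)))) s2 7
          (\<lambda>s'. ?Q (Suc i) (with_stack s' ((s' stack)(p + 3 := Suc (s' stack (p + 3))))))"
        by (intro runs_set_cell exI[of _ "h(p := h p + h (p + 4), p + 3 := Suc i)"] exI[of _ i])
          (use g h in auto)
    qed simp
    moreover have "s'(x := (s' x)(aval (Const 0) s' := aval (cell (p + 3)) s')) = with_stack (?s i) g"
    proof -
      have "aval (Const 0) s' = 0" "aval (cell (p + 3)) s' = i" using g by simp_all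
      then show ?thesis unfolding g(1)
        by (simp only: with_stack_upd(2)[OF x(1)] with_stack_apply(2)[OF x(1)] fun_upd_same fun_upd_upd)
    qed
    ultimately show ?thesis
      by (intro runs_seq[where ?c1.0 = "Assign x (Const 0) (cell (p + 3))" and ?T1.0 = 5
            and ?T2.0 = "time_bound W u + 10"] runs_assign) (simp_all del: fun_upd_apply)
  qed
  have loop: "runs (Seq (set_cell (p + 2) (Cell x (Const 0)))
     (Seq (set_cell p (Const 0))
     (Seq (count_loop (p + 3) (p + 1) ?body)
     (Assign x (Const 0) (cell (p + 2)))))) s1 (W * (time_bound W u + 30) + 30) (leaves s p (eval
         (Sum x t u) s))"
    if "leaves s (p + 1) ?n s1" for s1
  proof -
    from that obtain g where g: "s1 = with_stack s g" "g (p + 1) = ?n" "\<forall>q<p. g q = s stack q"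
      by (auto simp: leaves_def)
    let ?g = "g(p + 2 := ?c, p := 0)"
    \<comment> \<open>Writing the saved \<open>?c\<close> back makes the memory agree with
      \<open>s\<close> outside the stack again.\<close>
    have end_step: "runs (Assign x (Const 0) (cell (p + 2))) s' 4 (leaves s p (eval (Sum x t u) s))"
      if "?Q ?n s'" for s'
      using that by (intro runs_assign) (auto simp: fun_upd_def[symmetric])
    have "?n * (time_bound W u + 18 + 12) \<le> W * (time_bound W u + 30)"
      using n by (intro mult_le_mono) auto
    then have "runs (count_loop (p + 3) (p + 1) ?body) (with_stack s ?g) (W * (time_bound W u + 30) + 9)
       (?Q ?n)"
      by (intro runs_count_loop[where Q = ?Q and T = "time_bound W u + 18" and N = ?n] body)
        (use g in \<open>auto intro!: exI[of _ ?c]\<close>)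
    then have "runs (Seq (count_loop (p + 3) (p + 1) ?body) (Assign x (Const 0) (cell (p + 2))))
       (with_stack s ?g) (W * (time_bound W u + 30) + 13) (leaves s p (eval (Sum x t u) s))"
      by (intro runs_seq[where ?T2.0 = 4, OF runs_mono[OF _ order_refl end_step]]) auto
    then show ?thesis
      by (rule_tac runs_seq[where ?T1.0 = 4 and ?T2.0 = "W * (time_bound W u + 30) + 26"],
          rule_tac runs_set_cell,
          rule_tac runs_seq[where ?T1.0 = 3 and ?T2.0 = "W * (time_bound W u + 30) + 13"],
              rule_tac runs_set_cell)
        (use g in auto)
  qed
  show ?case unfolding compile.simps
    by (rule runs_seq[OF runs_mono[OF 1 order_refl loop]]) simp_all
qed

section \<open>Sequences of assignments of compiled terms\<close>

fun puts :: "(string \<times> tm \<times> tm) list \<Rightarrow> com" where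
  "puts [] = Skip"
| "puts ((x, i, t) # ps) =
     Seq (compile t 0) (Seq (compile i 1) (Seq (Assign x (cell 1) (cell 0)) (puts ps)))"

fun puts_result :: "(string \<times> tm \<times> tm) list \<Rightarrow> memory \<Rightarrow> memory" where
  "puts_result [] s = s"
| "puts_result ((x, i, t) # ps) s = puts_result ps (s(x := (s x)(eval i s := eval t s)))"

fun puts_stackless :: "(string \<times> tm \<times> tm) list \<Rightarrow> bool" where
  "puts_stackless [] \<longleftrightarrow> True"
| "puts_stackless ((x, i, t) # ps) \<longleftrightarrow> x \<noteq> stack \<and> stackless i \<and> stackless t \<and> puts_stackless ps"

fun puts_bounded :: "nat \<Rightarrow> (string \<times> tm \<times> tm) list \<Rightarrow> memory \<Rightarrow> bool" where
  "puts_bounded W [] s \<longleftrightarrow> True"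
| "puts_bounded W ((x, i, t) # ps) s \<longleftrightarrow> bounded_iters W i s \<and> bounded_iters W t s \<and>
     puts_bounded W ps (s(x := (s x)(eval i s := eval t s)))"

fun puts_time :: "nat \<Rightarrow> (string \<times> tm \<times> tm) list \<Rightarrow> nat" where
  "puts_time W [] = 1"
| "puts_time W ((x, i, t) # ps) = time_bound W t + time_bound W i + 5 + puts_time W ps"

lemma runs_puts:
  assumes "puts_stackless ps" "puts_bounded W ps s"
  shows "runs (puts ps) (with_stack s f) (puts_time W ps)
    (\<lambda>s'. \<exists>g. s' = with_stack (puts_result ps s) g)"
  using assms
proof (induction ps arbitrary: s f)
  case Nil
  then show ?case by (auto intro!: runs_skip)
next
  case (Cons p ps)
  obtain x i t where p [simp]: "p = (x, i, t)" by (cases p)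
  from Cons.prems have ok: "x \<noteq> stack" "stackless i" "stackless t" "puts_stackless ps"
    "bounded_iters W i s" "bounded_iters W t s"
    "puts_bounded W ps (s(x := (s x)(eval i s := eval t s)))" by auto
  have 1: "runs (compile t 0) (with_stack s f) (time_bound W t)
      (\<lambda>s'. \<exists>g. s' = with_stack s g \<and> g 0 = eval t s)"
    by (rule runs_mono[OF runs_compile[where t = t and s = "with_stack s f"]])
      (use ok in \<open>auto simp: leaves_def\<close>)
  have 2: "runs (compile i 1) (with_stack s g) (time_bound W i)
      (\<lambda>s'. \<exists>h. s' = with_stack s h \<and> h 0 = eval t s \<and> h 1 = eval i s)" if "g 0 = eval t s" for g
    by (rule runs_mono[OF runs_compile[where t = i and s = "with_stack s g"]])
      (use ok that in \<open>auto simp: leaves_def\<close>)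
  have 3: "runs (Seq (Assign x (cell 1) (cell 0)) (puts ps)) (with_stack s h) (5 + puts_time W ps)
      (\<lambda>s'. \<exists>g. s' = with_stack (puts_result (p # ps) s) g)"
    if "h 0 = eval t s" "h 1 = eval i s" for h
  proof -
    have "(with_stack s h)(x := (with_stack s h x)(aval (cell 1) (with_stack s h)
        := aval (cell 0) (with_stack s h))) = with_stack (s(x := (s x)(eval i s := eval t s))) h"
      using ok(1) that by simp
    then show ?thesis using Cons.IH[OF ok(4,7), of h]
      by (intro runs_seq[where ?T1.0 = 5 and ?T2.0 = "puts_time W ps"] runs_assign)
        (simp_all del: fun_upd_apply)
  qed
  have 4: "runs (Seq (compile i 1) (Seq (Assign x (cell 1) (cell 0)) (puts ps))) (with_stack s g)
      (time_bound W i + (5 + puts_time W ps)) (\<lambda>s'. \<exists>g. s' = with_stack (puts_result (p # ps) s) g)"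
    if "g 0 = eval t s" for g
    using 2[of g, OF that] by (rule runs_seq[OF runs_mono[OF _ order_refl]]) (use 3 in auto)
  show ?case unfolding p puts.simps
    by (rule runs_seq[OF runs_mono[OF 1 order_refl]]) (use 4 in auto)
qed

section \<open>Polynomial bounds, closed under sums and products\<close>

definition poly_bounded :: "(nat \<Rightarrow> nat) \<Rightarrow> bool" where
  "poly_bounded f \<longleftrightarrow> (\<exists>c. \<forall>W. f W \<le> (W + 2) ^ c)"

lemma poly_bounded_const: "poly_bounded (\<lambda>_. c)"
proof -
  have "c \<le> (W + 2) ^ c" for W
    using less_exp[of c] power_mono[of 2 "W + 2" c] by simp
  then show ?thesis unfolding poly_bounded_def by blast
qed

lemma poly_bounded_id: "poly_bounded (\<lambda>W. W)"
  unfolding poly_bounded_def by (intro exI[of _ 1]) simp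

text \<open>The base \<open>W + 2\<close> is at least 2 even at \<open>W = 0\<close>, so one extra
  factor absorbs the doubling caused by adding two powers.\<close>

lemma poly_bounded_add:
  assumes "poly_bounded f" "poly_bounded g"
  shows "poly_bounded (\<lambda>W. f W + g W)"
proof -
  from assms obtain c e where ce: "\<And>W. f W \<le> (W + 2) ^ c" "\<And>W. g W \<le> (W + 2) ^ e"
    unfolding poly_bounded_def by blast
  have "f W + g W \<le> (W + 2) ^ Suc (c + e)" for W
  proof -
    have "f W \<le> (W + 2) ^ (c + e)" "g W \<le> (W + 2) ^ (c + e)"
      using ce[of W] power_increasing[of c "c + e" "W + 2"] power_increasing[of e "c + e" "W + 2"]
      by linarith+
    then show ?thesis by simp
  qed
  then show ?thesis unfolding poly_bounded_def by blast
qed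

lemma poly_bounded_mult:
  assumes "poly_bounded f" "poly_bounded g"
  shows "poly_bounded (\<lambda>W. f W * g W)"
proof -
  from assms obtain c e where "\<And>W. f W \<le> (W + 2) ^ c" "\<And>W. g W \<le> (W + 2) ^ e"
    unfolding poly_bounded_def by blast
  then have "f W * g W \<le> (W + 2) ^ (c + e)" for W by (simp add: power_add mult_le_mono)
  then show ?thesis unfolding poly_bounded_def by blast
qed

lemma poly_bounded_time_bound: "poly_bounded (\<lambda>W. time_bound W t)"
  by (induction t) (simp_all only: time_bound.simps, (intro poly_bounded_add poly_bounded_mult
      poly_bounded_const poly_bounded_id | assumption)+)

lemma poly_bounded_puts_time: "poly_bounded (\<lambda>W. puts_time W ps)"
  by (induction ps) (force simp only: puts_time.simps split_paired_all intro: poly_bounded_add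
      poly_bounded_time_bound poly_bounded_const)+

section \<open>Vandermonde minors\<close>

definition idx_sign :: "nat set \<Rightarrow> nat \<Rightarrow> int" where
  "idx_sign I a = (-1) ^ card {c \<in> I. c < a}"

text \<open>For finite \<open>I\<close> this is the determinant with rows \<open>us\<close>, columns
  the elements of \<open>I\<close> in increasing order and entries \<open>(2 ^ u) ^ a\<close>,
  expanded along its first row with the cofactor signs \<open>idx_sign\<close>; it is 0 if the
  matrix is not square.\<close>

primrec minor :: "nat set \<Rightarrow> nat list \<Rightarrow> int" where
  "minor I [] = (if I = {} then 1 else 0)"
| "minor I (u # us) = (\<Sum>a\<in>I. idx_sign I a * 2 ^ (u * a) * minor (I - {a}) us)"

lemma minor_card: "finite I \<Longrightarrow> minor I us \<noteq> 0 \<Longrightarrow> card I = length us"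
proof (induction us arbitrary: I)
  case (Cons u us)
  then obtain a where a: "a \<in> I" "minor (I - {a}) us \<noteq> 0"
    by (metis (no_types, lifting) minor.simps(2) mult_zero_right sum.neutral)
  with Cons.IH[of "I - {a}"] Cons.prems show ?case
    by (metis card_Suc_Diff1 finite_Diff length_Cons)
qed (auto split: if_splits)

text \<open>Removing the smaller index lowers the rank of the larger one by one, while removing the
  larger leaves the rank of the smaller unchanged; so the two orders of removal differ in
  sign.\<close>

lemma idx_sign_swap:
  assumes "finite I" "a \<in> I" "b \<in> I" "a < b"
  shows "idx_sign I a * idx_sign (I - {a}) b = - (idx_sign I b * idx_sign (I - {b}) a)"
proof -
  have 1: "{c \<in> I - {b}. c < a} = {c \<in> I. c < a}" using assms by auto
  have "{c \<in> I. c < b} = insert a {c \<in> I - {a}. c < b}" using assms by auto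
  then have "card {c \<in> I. c < b} = Suc (card {c \<in> I - {a}. c < b})"
    using assms by simp
  then show ?thesis unfolding idx_sign_def 1 by simp
qed

lemma minor_Cons2:
  "minor I (u # v # us) = (\<Sum>(a, b)\<in>Sigma I (\<lambda>a. I - {a}).
      idx_sign I a * idx_sign (I - {a}) b * 2 ^ (u * a + v * b) * minor (I - {a} - {b}) us)"
  if "finite I"
  using that
  by (simp add: sum.Sigma[symmetric] sum_distrib_left power_add mult_ac)

text \<open>Expanding along both leading rows gives a sum over ordered pairs of distinct columns,
  and exchanging the rows amounts to swapping each pair, which flips its sign.\<close>

lemma minor_swap:
  assumes "finite I"
  shows "minor I (u # v # us) = - minor I (v # u # us)"
proof -
  let ?P = "Sigma I (\<lambda>a. I - {a})"
  let ?f = "\<lambda>u v (a, b). idx_sign I a * idx_sign (I - {a}) b * 2 ^ (u * a + v * b) * minor (I -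
      {a} - {b}) us"
  have "bij_betw prod.swap ?P ?P" by (rule bij_betw_byWitness[where f' = prod.swap]) auto
  then have "sum (?f v u) ?P = (\<Sum>p\<in>?P. ?f v u (prod.swap p))"
    by (rule sum.reindex_bij_betw[symmetric])
  also have "\<dots> = (\<Sum>p\<in>?P. - ?f u v p)"
  proof (rule sum.cong[OF refl])
    fix p assume "p \<in> ?P"
    then obtain a b where p: "p = (a, b)" "a \<in> I" "b \<in> I" "a \<noteq> b" by auto
    have "idx_sign I b * idx_sign (I - {b}) a = - (idx_sign I a * idx_sign (I - {a}) b)"
      using idx_sign_swap[OF assms, of a b] idx_sign_swap[OF assms, of b a] p by (cases "a < b") auto
    moreover have "I - {b} - {a} = I - {a} - {b}" by auto
    ultimately show "?f v u (prod.swap p) = - ?f u v p" by (simp add: p add_ac)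
  qed
  also have "\<dots> = - sum (?f u v) ?P" by (simp add: sum_negf)
  finally show ?thesis unfolding minor_Cons2[OF assms] by simp
qed

text \<open>If the second row equals the first, the swap shows that the determinant is its own
  negative. Otherwise the swap brings the second row to the front, and expansion along it leaves
  minors that still repeat \<open>u\<close>.\<close>

lemma minor_repeat_hd: "finite I \<Longrightarrow> u \<in> set us \<Longrightarrow> minor I (u # us) = 0"
proof (induction us arbitrary: I)
  case (Cons v us)
  show ?case
  proof (cases "u = v")
    case True
    with minor_swap[OF Cons.prems(1), of u v us] show ?thesis by simp
  next
    case False
    with Cons have "minor (I - {a}) (u # us) = 0" for a by simp
    then have "minor I (v # u # us) = 0" by (simp only: minor.simps(2)[of I v]) simp
    with minor_swap[OF Cons.prems(1), of u v us] show ?thesis by simp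
  qed
qed simp

lemma minor_repeat: "finite I \<Longrightarrow> \<not> distinct us \<Longrightarrow> minor I us = 0"
proof (induction us arbitrary: I)
  case (Cons u us)
  then show ?case
    by (cases "u \<in> set us") (simp_all only: minor_repeat_hd, simp)
qed simp

text \<open>Vandermonde: in the variable \<open>2 ^ u\<close>, the expansion along \<open>u\<close> is a nonzero polynomial of degree
  \<open>length us\<close> that already vanishes at the \<open>length us\<close> points \<open>2 ^ v\<close> with \<open>v \<in> set us\<close>.\<close>

lemma minor_nonzero: "distinct us \<Longrightarrow> minor {..<length us} us \<noteq> 0"
proof (induction us)
  case (Cons u us)
  let ?n = "length us" and ?I = "{..<Suc (length us)}"
  define q where "q = (\<Sum>a\<in>?I. monom (idx_sign ?I a * minor (?I - {a}) us) a)"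
  have poly_q: "poly q (2 ^ v) = minor ?I (v # us)" for v
    by (simp add: q_def poly_sum poly_monom power_mult[symmetric] mult_ac del: sum.lessThan_Suc)
  have coeff_q: "coeff q b = (if b < Suc ?n then idx_sign ?I b * minor (?I - {b}) us else 0)" for b
    by (auto simp add: q_def coeff_sum coeff_monom if_distrib sum.delta' cong: if_cong)
  have "?I - {?n} = {..<?n}" by auto
  \<comment> \<open>Up to sign the leading coefficient is the minor of \<open>us\<close> on the
    first \<open>?n\<close> columns, nonzero by the induction hypothesis.\<close>
  then have top: "coeff q ?n \<noteq> 0" using Cons by (simp add: coeff_q idx_sign_def)
  then have "q \<noteq> 0" by auto
  have "degree q \<le> ?n" by (rule degree_le) (simp add: coeff_q)
  show ?case
  proof
    assume "minor {..<length (u # us)} (u # us) = 0"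
    then have "(\<lambda>v. 2 ^ v) ` set (u # us) \<subseteq> {x. poly q x = 0}"
      using minor_repeat_hd[of ?I] by (auto simp add: poly_q simp del: minor.simps)
    then have "card ((\<lambda>v. 2 ^ v :: int) ` set (u # us)) \<le> card {x. poly q x = 0}"
      by (intro card_mono poly_roots_finite \<open>q \<noteq> 0\<close>)
    also have "\<dots> \<le> degree q" by (rule card_poly_roots_bound[OF \<open>q \<noteq> 0\<close>])
    finally have "card ((\<lambda>v. 2 ^ v :: int) ` set (u # us)) \<le> ?n" using \<open>degree q \<le> ?n\<close> by simp
    moreover have "inj_on (\<lambda>v. 2 ^ v :: int) (set (u # us))" by (auto simp: inj_on_def)
    ultimately show False using Cons.prems by (simp add: card_image distinct_card)
  qed
qed simp

text \<open>Besides distinctness, a nonzero minor forces exactly \<open>d\<close> matched positions,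
  which is why partial mappings are padded to a fixed size.\<close>

corollary minor_eq_0_iff:
  "minor {..<d} us \<noteq> 0 \<longleftrightarrow> distinct us \<and> length us = d"
  using minor_nonzero minor_repeat minor_card[of "{..<d}" us] by auto

lemma abs_minor_le:
  assumes "I \<subseteq> {..<d}" "\<And>u. u \<in> set us \<Longrightarrow> u \<le> n"
  shows "\<bar>minor I us\<bar> \<le> (int d * 2 ^ (n * d)) ^ length us"
  using assms
proof (induction us arbitrary: I)
  case (Cons u us)
  have fin: "finite I" and cd: "card I \<le> d"
    using Cons.prems(1) finite_subset card_mono[OF _ Cons.prems(1)] by auto
  have tm: "\<bar>idx_sign I a * 2 ^ (u * a) * minor (I - {a}) us\<bar> \<le> 2 ^ (n * d) * (int d * 2 ^ (n *
      d)) ^ length us"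
    if "a \<in> I" for a
  proof -
    have "u * a \<le> n * d" using that Cons.prems by (intro mult_le_mono) auto
    then have "(2::int) ^ (u * a) \<le> 2 ^ (n * d)" by (intro power_increasing) auto
    moreover have "\<bar>minor (I - {a}) us\<bar> \<le> (int d * 2 ^ (n * d)) ^ length us"
      using Cons.prems by (intro Cons.IH) auto
    ultimately show ?thesis by (simp add: abs_mult idx_sign_def power_abs mult_mono)
  qed
  have "\<bar>minor I (u # us)\<bar> \<le> (\<Sum>a\<in>I. \<bar>idx_sign I a * 2 ^ (u * a) * minor (I - {a}) us\<bar>)"
    unfolding minor.simps by (rule sum_abs)
  also have "\<dots> \<le> (\<Sum>a\<in>I. 2 ^ (n * d) * (int d * 2 ^ (n * d)) ^ length us)"
    by (rule sum_mono) (rule tm)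
  also have "\<dots> \<le> int d * (2 ^ (n * d) * (int d * 2 ^ (n * d)) ^ length us)"
    using cd by (simp add: mult_right_mono)
  finally show ?case by (simp add: mult_ac)
qed simp

section \<open>The dynamic program\<close>

text \<open>
  A partial mapping of a prefix of \<open>A\<close> is the list of its values with the last position first, where
  0 stands for an unmatched position and \<open>j + 1\<close> for the position \<open>j\<close> of \<open>B\<close>.
\<close>

fun prev :: "nat list \<Rightarrow> nat" where
  "prev [] = 0"
| "prev (j # m) = j"

text \<open>The guard \<open>0 < prev m\<close> matters at \<open>j = 1\<close>: an unmatched
  position followed by position 0 of \<open>B\<close> gives the values 0 and 1, which form no
  duo.\<close>

primrec duos :: "nat list \<Rightarrow> nat" where
  "duos [] = 0"
| "duos (j # m) = (if 0 < prev m \<and> j = Suc (prev m) then 1 else 0) + duos m"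

text \<open>The last value \<open>j\<close> is a parameter because the next duo depends on no
  earlier value; the empty prefix counts as ending unmatched. Values may repeat, since the minors of
  such paths vanish.\<close>

primrec paths :: "nat list \<Rightarrow> nat list \<Rightarrow> nat \<Rightarrow> nat \<Rightarrow> nat list list" where
  "paths A B 0 j = (if j = 0 then [[]] else [])"
| "paths A B (Suc i) j = (if j = 0 \<or> A ! i = B ! (j - 1)
     then concat (map (\<lambda>j'. map ((#) j) (paths A B i j')) [0..<Suc (length B)]) else [])"

definition used :: "nat list \<Rightarrow> nat list" where
  "used m = filter (\<lambda>j. j \<noteq> 0) m"

text \<open>For \<open>I = J\<close> the minors form a square, hence the weight is nonnegative; the
  recursion removes exponents from \<open>I\<close> and \<open>J\<close> independently and therefore
  carries both.\<close>

definition weight :: "nat \<Rightarrow> nat set \<Rightarrow> nat set \<Rightarrow> nat list \<Rightarrow> int" where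
  "weight L I J m = 2 ^ (L * duos m) * minor I (used m) * minor J (used m)"

definition bits :: "nat \<Rightarrow> nat set" where
  "bits I = {a. bit I a}"

definition low_bits :: "nat \<Rightarrow> nat \<Rightarrow> nat" where
  "low_bits I a = (\<Sum>c<a. of_bool (bit I c))"

text \<open>
  \<open>I\<close> and \<open>J\<close> are bit masks. Memory cells hold natural numbers, so the terms of positive and of negative
  sign are summed separately, for \<open>s = 0\<close> and \<open>s = 1\<close>.
\<close>

primrec table :: "nat list \<Rightarrow> nat list \<Rightarrow> nat \<Rightarrow> nat \<Rightarrow> nat \<Rightarrow> nat \<Rightarrow> nat \<Rightarrow> nat \<Rightarrow> nat \<Rightarrow> nat" where
  "table A B L d 0 j I J s = (if j = 0 \<and> I = 0 \<and> J = 0 \<and> s = 0 then 1 else 0)"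
| "table A B L d (Suc i) j I J s =
     (if j = 0 then (\<Sum>j'<Suc (length B). table A B L d i j' I J s)
      else if A ! i = B ! (j - 1) then
        (\<Sum>j'<Suc (length B). \<Sum>a<d. \<Sum>b<d. if bit I a \<and> bit J b then
          table A B L d i j' (I - 2 ^ a) (J - 2 ^ b) ((s + low_bits I a + low_bits J b) mod 2)
            * 2 ^ (j * (a + b) + (if 0 < j' \<and> j = Suc j' then L else 0)) else 0)
      else 0)"

section \<open>Bit masks as sets of exponents\<close>

lemma bit_imp_le: "bit (I::nat) a \<Longrightarrow> 2 ^ a \<le> I"
  by (metis bit_nat_def div_less even_zero linorder_not_less bit_iff_odd)

text \<open>The machine has no bit operations, so a spent exponent is removed from a mask by
  subtracting its power of two.\<close>

lemma minus_exp_eq_unset_bit: "bit (I::nat) a \<Longrightarrow> I - 2 ^ a = unset_bit a I"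
proof -
  assume "bit I a"
  then have "int (I - 2 ^ a) = int (unset_bit a I)"
    using bit_imp_le[of I a] by (simp add: of_nat_diff of_nat_unset_bit_eq unset_bit_eq
        bit_of_nat_iff_bit)
  then show ?thesis by simp
qed

lemma bits_minus: "a \<in> bits I \<Longrightarrow> bits (I - 2 ^ a) = bits I - {a}"
  by (auto simp: bits_def minus_exp_eq_unset_bit bit_unset_bit_iff)

lemma bits_less: "I < 2 ^ d \<Longrightarrow> bits I \<subseteq> {..<d}"
proof
  fix a assume "I < 2 ^ d" "a \<in> bits I"
  then have "(2::nat) ^ a < 2 ^ d" using bit_imp_le[of I a] le_less_trans unfolding bits_def by blast
  then show "a \<in> {..<d}" by simp
qed

lemma bits_full: "bits (2 ^ d - 1) = {..<d}"
  unfolding bits_def mask_eq_exp_minus_1[symmetric] by (auto simp: bit_mask_iff)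

lemma bits_0: "bits I = {} \<longleftrightarrow> I = 0"
  by (auto simp: bits_def bit_eq_iff)

lemma idx_sign_bits: "idx_sign (bits I) a = (-1) ^ low_bits I a"
proof -
  have "{c \<in> bits I. c < a} = {..<a} \<inter> {c. bit I c}" by (auto simp: bits_def)
  then show ?thesis by (simp add: idx_sign_def low_bits_def sum_of_bool_eq)
qed

lemma sum_list_concat: "sum_list (concat xss) = (\<Sum>xs\<leftarrow>xss. sum_list xs)"
  by (induction xss) simp_all

lemma sum_list_sum: "(\<Sum>m\<leftarrow>ms. \<Sum>a\<in>I. f m a) = (\<Sum>a\<in>I. \<Sum>m\<leftarrow>ms. f m (a::'a) :: int)"
  by (induction ms) (simp_all add: sum.distrib)

lemma prev_paths: "m \<in> set (paths A B i j) \<Longrightarrow> prev m = j"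
  by (cases i) (auto split: if_splits)

lemma weight_Cons_0: "weight L I J (0 # m) = weight L I J m"
  by (simp add: weight_def used_def)

text \<open>The two expansions along the row \<open>j\<close> are multiplied, and their entries
  combine to \<open>2 ^ (j * (a + b))\<close>; together with the possible \<open>2 ^ L\<close> this
  is a single shift.\<close>

lemma weight_Cons:
  assumes "0 < j"
  shows "weight L I J (j # m) = (\<Sum>a\<in>I. \<Sum>b\<in>J. idx_sign I a * idx_sign J b
     * 2 ^ (j * (a + b) + (if 0 < prev m \<and> j = Suc (prev m) then L else 0))
     * weight L (I - {a}) (J - {b}) m)"
  using assms
  by (simp add: weight_def used_def sum_product sum_distrib_left power_add
      algebra_simps cong: sum.cong)

lemma sum_bits:
  assumes "I < 2 ^ d"
  shows "(\<Sum>a<d. if bit I a then f a else 0) = (\<Sum>a\<in>bits I. f a :: int)"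
proof -
  have "bits I = {a \<in> {..<d}. bit I a}" using bits_less[OF assms] by (auto simp: bits_def)
  then show ?thesis by (simp only: sum.inter_filter[OF finite_lessThan])
qed

text \<open>The difference obeys the same recursion as the sum of the weights: appending
  \<open>j\<close> expands both minors as in \<open>weight_Cons\<close>, and a negative cofactor
  sign exchanges the two parts. The bounds on \<open>I\<close> and \<open>J\<close> ensure that the
  indices below \<open>d\<close> reach every bit.\<close>

lemma table_diff:
  assumes "I < 2 ^ d" "J < 2 ^ d"
  shows "int (table A B L d i j I J 0) - int (table A B L d i j I J 1)
    = (\<Sum>m\<leftarrow>paths A B i j. weight L (bits I) (bits J) m)"
  using assms
proof (induction i arbitrary: j I J)
  case 0
  then show ?case by (simp add: weight_def used_def bits_0)
next
  case (Suc i)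
  let ?T = "table A B L d i" and ?N = "Suc (length B)"
  show ?case
  proof (cases "j = 0")
    case True
    have "int (table A B L d (Suc i) j I J 0) - int (table A B L d (Suc i) j I J 1)
        = (\<Sum>j'<?N. int (?T j' I J 0) - int (?T j' I J 1))"
      by (simp only: table.simps True simp_thms if_True of_nat_sum sum_subtractf)
    also have "\<dots> = (\<Sum>j'<?N. \<Sum>m\<leftarrow>paths A B i j'. weight L (bits I) (bits J) m)"
      using Suc by simp
    finally show ?thesis
      by (simp add: True sum_list_concat map_concat weight_Cons_0 o_def
          interv_sum_list_conv_sum_set_nat atLeast0LessThan)
  next
    case False
    show ?thesis
    proof (cases "A ! i = B ! (j - 1)")
      case eq: True
      let ?e = "\<lambda>j' a b. j * (a + b) + (if 0 < j' \<and> j = Suc j' then L else 0)"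
      let ?p = "\<lambda>a b. low_bits I a + low_bits J b"
      \<comment> \<open>An odd \<open>p\<close> exchanges the two tables, which negates their
        difference.\<close>
      have flip: "int (?T j' I J ((0 + p) mod 2)) - int (?T j' I J ((1 + p) mod 2))
          = (-1) ^ p * (int (?T j' I J 0) - int (?T j' I J 1))" for j' I J p
        by (cases "even p") (auto simp: even_iff_mod_2_eq_zero odd_iff_mod_2_eq_one mod_Suc)
      have "int (table A B L d (Suc i) j I J 0) - int (table A B L d (Suc i) j I J 1)
        = (\<Sum>j'<?N. \<Sum>a<d. \<Sum>b<d. if bit I a \<and> bit J b then
            (int (?T j' (I - 2 ^ a) (J - 2 ^ b) ((0 + ?p a b) mod 2))
             - int (?T j' (I - 2 ^ a) (J - 2 ^ b) ((1 + ?p a b) mod 2))) * 2 ^ ?e j' a b else 0)"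
        unfolding table.simps using False eq
        by (simp only: simp_thms if_False if_True of_nat_sum sum_subtractf[symmetric])
          (intro sum.cong refl, auto simp: algebra_simps)
      also have "\<dots> = (\<Sum>j'<?N. \<Sum>a<d. if bit I a then \<Sum>b<d. if bit J b then
            (-1) ^ ?p a b * 2 ^ ?e j' a b *
            (\<Sum>m\<leftarrow>paths A B i j'. weight L (bits (I - 2 ^ a)) (bits (J - 2 ^ b)) m) else 0 else 0)"
      proof (intro sum.cong refl)
        fix j' a
        show "(\<Sum>b<d. if bit I a \<and> bit J b then
            (int (?T j' (I - 2 ^ a) (J - 2 ^ b) ((0 + ?p a b) mod 2))
             - int (?T j' (I - 2 ^ a) (J - 2 ^ b) ((1 + ?p a b) mod 2))) * 2 ^ ?e j' a b else 0)
          = (if bit I a then \<Sum>b<d. if bit J b then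
            (-1) ^ ?p a b * 2 ^ ?e j' a b *
            (\<Sum>m\<leftarrow>paths A B i j'. weight L (bits (I - 2 ^ a)) (bits (J - 2 ^ b)) m) else 0 else 0)"
        proof (cases "bit I a")
          case True
          have "I - 2 ^ a < 2 ^ d" "J - 2 ^ b < 2 ^ d" for b
            using Suc.prems by (auto intro: le_less_trans[OF diff_le_self])
          then show ?thesis
            unfolding flip by (simp only: True simp_thms if_True)
              (intro sum.cong if_cong refl, simp_all add: Suc.IH[simplified One_nat_def] mult_ac)
        qed simp
      qed
      also have "\<dots> = (\<Sum>j'<?N. \<Sum>a\<in>bits I. \<Sum>b\<in>bits J. (-1) ^ ?p a b * 2 ^ ?e j' a b *
            (\<Sum>m\<leftarrow>paths A B i j'. weight L (bits (I - 2 ^ a)) (bits (J - 2 ^ b)) m))"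
        using Suc.prems by (simp only: sum_bits)
      also have "\<dots> = (\<Sum>j'<?N. \<Sum>a\<in>bits I. \<Sum>b\<in>bits J. (-1) ^ ?p a b * 2 ^ ?e j' a b *
            (\<Sum>m\<leftarrow>paths A B i j'. weight L (bits I - {a}) (bits J - {b}) m))"
        by (intro sum.cong refl) (simp add: bits_minus)
      also have "\<dots> = (\<Sum>j'<?N. \<Sum>m\<leftarrow>paths A B i j'. weight L (bits I) (bits J) (j # m))"
      proof (intro sum.cong refl)
        fix j'
        \<comment> \<open>All these paths end in \<open>j'\<close>, so the exponent of the duo
          factor is the same for each of them and can be read off from \<open>j'\<close>.\<close>
        have "(\<Sum>m\<leftarrow>paths A B i j'. weight L (bits I) (bits J) (j # m)) =
           (\<Sum>m\<leftarrow>paths A B i j'. \<Sum>a\<in>bits I. \<Sum>b\<in>bits J. (-1) ^ ?p a b * 2 ^ ?e j' a b *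
              weight L (bits I - {a}) (bits J - {b}) m)"
          using False by (intro arg_cong[where f = sum_list] map_cong refl)
            (simp add: weight_Cons prev_paths idx_sign_bits power_add cong: if_cong)
        then show "(\<Sum>a\<in>bits I. \<Sum>b\<in>bits J. (-1) ^ ?p a b * 2 ^ ?e j' a b *
            (\<Sum>m\<leftarrow>paths A B i j'. weight L (bits I - {a}) (bits J - {b}) m)) =
            (\<Sum>m\<leftarrow>paths A B i j'. weight L (bits I) (bits J) (j # m))"
          by (simp add: sum_list_sum sum_list_const_mult)
      qed
      finally show ?thesis using False eq
        by (simp add: sum_list_concat map_concat o_def interv_sum_list_conv_sum_set_nat
            atLeast0LessThan)
    qed (use False in simp)
  qed
qed

section \<open>Partial mappings as paths\<close>

definition entry :: "nat list \<Rightarrow> nat \<Rightarrow> nat" where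
  "entry m p = rev m ! p"

lemma entry_Cons: "p < length m \<Longrightarrow> entry (j # m) p = entry m p" "entry (j # m) (length m) = j"
  by (simp_all add: entry_def nth_append)

text \<open>The recursion limits only the predecessors of the last value to
  \<open>{..length B}\<close>; the assumption on \<open>j\<close> does the same for the last value
  itself.\<close>

lemma paths_iff:
  "m \<in> set (paths A B i j) \<longleftrightarrow> length m = i \<and> prev m = j \<and> set m \<subseteq> {..length B} \<and>
     (\<forall>p<i. entry m p = 0 \<or> A ! p = B ! (entry m p - 1))" if "j \<le> length B"
  using that
proof (induction i arbitrary: j m)
  case (Suc i)
  show ?case
  proof (cases m)
    case (Cons x m')
    have "m \<in> set (paths A B (Suc i) j) \<longleftrightarrow> x = j \<and> (j = 0 \<or> A ! i = B ! (j - 1)) \<and>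
       (\<exists>j'\<in>{..length B}. m' \<in> set (paths A B i j'))"
      by (auto simp: Cons less_Suc_eq_le simp del: upt_Suc)
    also have "(\<exists>j'\<in>{..length B}. m' \<in> set (paths A B i j')) \<longleftrightarrow> length m' = i \<and> set m' \<subseteq> {..length B} \<and>
       (\<forall>p<i. entry m' p = 0 \<or> A ! p = B ! (entry m' p - 1))"
    proof -
      have "prev m' \<le> length B" if "set m' \<subseteq> {..length B}" using that by (cases m') auto
      then show ?thesis using Suc.IH[of _ m'] by auto
    qed
    finally show ?thesis using Suc.prems unfolding Cons
      by (auto simp: All_less_Suc entry_Cons)
  qed auto
qed auto

lemma duos_entry:
  "duos m = card {p. Suc p < length m \<and> 0 < entry m p \<and> entry m (Suc p) = Suc (entry m p)}"
proof (induction m)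
  case (Cons j m)
  let ?S = "\<lambda>m. {p. Suc p < length m \<and> 0 < entry m p \<and> entry m (Suc p) = Suc (entry m p)}"
  have fin: "finite (?S m)" by (rule finite_subset[of _ "{..<length m}"]) auto
  show ?case
  proof (cases m)
    case (Cons x m')
    have *: "?S (j # m) = ?S m \<union> (if 0 < x \<and> j = Suc x then {length m'} else {})"
    proof (rule set_eqI)
      fix p
      consider "p < length m'" | "p = length m'" | "p > length m'" by linarith
      then show "p \<in> ?S (j # m) \<longleftrightarrow> p \<in> ?S m \<union> (if 0 < x \<and> j = Suc x then {length m'} else {})"
      proof cases
        case 1
        then show ?thesis
          using entry_Cons(1)[of p m j] entry_Cons(1)[of "Suc p" m j] by (auto simp: Cons)
      next
        case 2
        have "entry (j # m) p = x" "entry (j # m) (Suc p) = j"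
          using entry_Cons(1)[of p m j] entry_Cons(2)[of x m'] entry_Cons(2)[of j m] 2
          by (simp_all add: Cons)
        then show ?thesis using 2 by (auto simp: Cons)
      qed (auto simp: Cons)
    qed
    have "length m' \<notin> ?S m" by (simp add: Cons)
    then show ?thesis unfolding * using Cons.IH fin by (simp add: Cons)
  qed simp
qed simp

lemma used_entry:
  "distinct (used m) \<longleftrightarrow> inj_on (entry m) {p. p < length m \<and> entry m p \<noteq> 0}"
  "length (used m) = card {p. p < length m \<and> entry m p \<noteq> 0}"
proof -
  have "rev m = map (entry m) [0..<length m]"
    by (rule nth_equalityI) (simp_all add: entry_def)
  then have *: "rev (used m) = map (entry m) (filter (\<lambda>p. entry m p \<noteq> 0) [0..<length m])"
    unfolding used_def rev_filter by (simp add: filter_map o_def)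
  have "distinct (used m) \<longleftrightarrow> distinct (rev (used m))" by simp
  then show "distinct (used m) \<longleftrightarrow> inj_on (entry m) {p. p < length m \<and> entry m p \<noteq> 0}"
    unfolding * by (simp add: distinct_map)
  have "length (used m) = length (rev (used m))" by simp
  then show "length (used m) = card {p. p < length m \<and> entry m p \<noteq> 0}"
    unfolding * by (simp add: length_filter_conv_card)
      (intro arg_cong[where f = card] Collect_cong, auto)
qed

lemma count_eq_card_nth: "count (mset xs) c = card {p. p < length xs \<and> xs ! p = c}"
  by (simp add: count_mset count_list_eq_length_filter length_filter_conv_card eq_commute[of c])

text \<open>Every symbol occurs equally often in \<open>A\<close> and \<open>B\<close>, and
  \<open>f\<close> uses up equally many occurrences on both sides, so the free ones can be matched
  by a bijection; these bijections are glued over all symbols.\<close>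

lemma extend_partial_mapping:
  assumes "related A B" and Q: "Q \<subseteq> {..<length A}" and inj: "inj_on f Q"
    and f: "f ` Q \<subseteq> {..<length B}" "\<And>p. p \<in> Q \<Longrightarrow> A ! p = B ! f p"
  obtains m where "is_mapping A B m" "\<And>p. p \<in> Q \<Longrightarrow> m p = f p"
proof -
  let ?X = "\<lambda>c. {p \<in> {..<length A} - Q. A ! p = c}" and ?Y = "\<lambda>c. {q \<in> {..<length B} - f ` Q. B !
      q = c}"
  have "\<exists>h. bij_betw h (?X c) (?Y c)" for c
  proof (rule finite_same_card_bij)
    have finQ: "finite Q" using Q finite_subset by blast
    have X: "?X c = {p. p < length A \<and> A ! p = c} - {p \<in> Q. A ! p = c}" by auto
    have Y: "?Y c = {q. q < length B \<and> B ! q = c} - f ` {p \<in> Q. A ! p = c}" using f(2) by auto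
    have "card (?X c) = card {p. p < length A \<and> A ! p = c} - card {p \<in> Q. A ! p = c}"
      unfolding X using finQ Q by (intro card_Diff_subset) auto
    moreover have "card (?Y c) = card {q. q < length B \<and> B ! q = c} - card (f ` {p \<in> Q. A ! p = c})"
      unfolding Y using finQ f by (intro card_Diff_subset) auto
    moreover have "card (f ` {p \<in> Q. A ! p = c}) = card {p \<in> Q. A ! p = c}"
      by (rule card_image) (rule inj_on_subset[OF inj], auto)
    moreover have "card {p. p < length A \<and> A ! p = c} = card {q. q < length B \<and> B ! q = c}"
      using assms(1) by (simp add: related_def flip: count_eq_card_nth)
    ultimately show "card (?X c) = card (?Y c)" by simp
  qed auto
  then have "\<forall>c. \<exists>h. bij_betw h (?X c) (?Y c)" ..
  from choice[OF this] obtain h where "\<forall>c. bij_betw (h c) (?X c) (?Y c)" ..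
  then have h: "bij_betw (h c) (?X c) (?Y c)" for c ..
  let ?h = "\<lambda>p. h (A ! p) p"
  have hY: "?h p \<in> ?Y (A ! p)" if "p \<in> {..<length A} - Q" for p
    by (rule bspec[OF bij_betwE[OF h[of "A ! p"]]]) (use that in simp)
  have "bij_betw ?h ({..<length A} - Q) ({..<length B} - f ` Q)"
  proof (intro bij_betw_imageI inj_onI equalityI subsetI)
    fix p q assume pq: "p \<in> {..<length A} - Q" "q \<in> {..<length A} - Q" "?h p = ?h q"
    from hY[OF pq(1)] have "B ! ?h p = A ! p" unfolding mem_Collect_eq by (rule conjunct2)
    moreover from hY[OF pq(2)] have "B ! ?h q = A ! q" unfolding mem_Collect_eq by (rule conjunct2)
    \<comment> \<open>The symbol of \<open>B\<close> at the common image reveals that both positions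
      carry the same symbol, so that both belong to one of the glued bijections.\<close>
    ultimately have eq: "A ! q = A ! p" using pq(3) by metis
    have "h (A ! p) p = h (A ! p) q" using pq(3) unfolding eq .
    then show "p = q"
      by (rule inj_onD[OF bij_betw_imp_inj_on[OF h[of "A ! p"]]]) (use pq(1,2) in \<open>simp_all add: eq\<close>)
  next
    fix q assume "q \<in> ?h ` ({..<length A} - Q)"
    then obtain p where "p \<in> {..<length A} - Q" "q = ?h p" ..
    with hY[of p] show "q \<in> {..<length B} - f ` Q" by simp
  next
    fix q assume "q \<in> {..<length B} - f ` Q"
    then have "q \<in> ?Y (B ! q)" by simp
    then have "q \<in> h (B ! q) ` ?X (B ! q)" unfolding bij_betw_imp_surj_on[OF h] .
    then obtain p where "q = h (B ! q) p" "p \<in> ?X (B ! q)" ..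
    then show "q \<in> ?h ` ({..<length A} - Q)" by (intro image_eqI[of _ _ p]) simp_all
  qed
  from bij_betw_disjoint_Un[OF inj_on_imp_bij_betw[OF inj] this]
  have "bij_betw (\<lambda>p. if p \<in> Q then f p else ?h p) {..<length A} {..<length B}"
    using Q f(1) by (simp add: Un_absorb1)
  moreover have "A ! p = B ! (if p \<in> Q then f p else ?h p)" if "p < length A" for p
  proof (cases "p \<in> Q")
    case False
    with that have "?h p \<in> ?Y (A ! p)" by (intro hY) blast
    with False show ?thesis by simp
  qed (simp add: f(2))
  ultimately have "is_mapping A B (\<lambda>p. if p \<in> Q then f p else ?h p)"
    unfolding is_mapping_def by blast
  then show ?thesis by (rule that) simp
qed

lemma max_duo_psm_iff_path:
  assumes "related A B"
  shows "max_duo_psm A B k \<longleftrightarrow> (\<exists>j\<le>length B. \<exists>m\<in>set (paths A B (length A) j).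
    k \<le> duos m \<and> distinct (used m) \<and> length (used m) = min (2 * k) (length A))"
proof
  let ?n = "length A"
  have len: "length B = ?n" using assms[unfolded related_def, THEN mset_eq_length] by simp
  assume "max_duo_psm A B k"
  then obtain f where f: "bij_betw f {..<?n} {..<?n}" "\<And>p. p < ?n \<Longrightarrow> A ! p = B ! f p"
    and kf: "k \<le> card (preserved_duos A f)"
    unfolding max_duo_psm_def is_mapping_def len by blast
  from kf obtain K where K: "K \<subseteq> preserved_duos A f" "card K = k" "finite K"
    by (rule obtain_subset_with_card_n)
  have "card (K \<union> Suc ` K) \<le> 2 * k"
    using card_Un_le[of K "Suc ` K"] K by (simp add: card_image)
  moreover have sub: "K \<union> Suc ` K \<subseteq> {..<?n}" using K(1) by (auto simp: preserved_duos_def)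
  moreover from card_mono[OF _ sub] have "card (K \<union> Suc ` K) \<le> ?n" by simp
  \<comment> \<open>The positions touched by \<open>K\<close> are padded to exactly
    \<open>min (2 * k) ?n\<close> positions, because the minors accept no other size.\<close>
  ultimately obtain Q where Q: "K \<union> Suc ` K \<subseteq> Q" "Q \<subseteq> {..<?n}" "card Q = min (2 * k) ?n"
    using exists_subset_between[of "K \<union> Suc ` K" "min (2 * k) ?n" "{..<?n}"] by auto
  define m where "m = rev (map (\<lambda>p. if p \<in> Q then Suc (f p) else 0) [0..<?n])"
  have m: "length m = ?n" "\<And>p. p < ?n \<Longrightarrow> entry m p = (if p \<in> Q then Suc (f p) else 0)"
    by (simp_all add: m_def entry_def)
  have fless: "f p < ?n" if "p < ?n" for p using bij_betwE[OF f(1)] that by auto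
  have le: "set m \<subseteq> {..length B}" by (auto simp: m_def len Suc_le_eq fless)
  then have "prev m \<le> length B" by (cases m) auto
  have Qeq: "{p. p < length m \<and> entry m p \<noteq> 0} = Q" using Q(2) by (auto simp: m split: if_splits)
  have "m \<in> set (paths A B ?n (prev m))"
    unfolding paths_iff[OF \<open>prev m \<le> length B\<close>] using le m by (simp flip: f(2))
  moreover have "k \<le> duos m"
    unfolding duos_entry K(2)[symmetric]
  proof (rule card_mono)
    show "finite {p. Suc p < length m \<and> 0 < entry m p \<and> entry m (Suc p) = Suc (entry m p)}"
      by (rule finite_subset[of _ "{..<length m}"]) auto
    show "K \<subseteq> {p. Suc p < length m \<and> 0 < entry m p \<and> entry m (Suc p) = Suc (entry m p)}"
    proof
      fix p assume "p \<in> K"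
      then have "p \<in> Q" "Suc p \<in> Q" "p \<in> preserved_duos A f" using Q(1) K(1) by auto
      then show "p \<in> {p. Suc p < length m \<and> 0 < entry m p \<and> entry m (Suc p) = Suc (entry m p)}"
        by (simp add: preserved_duos_def m)
    qed
  qed
  moreover have "inj_on (entry m) Q"
    using bij_betw_imp_inj_on[OF f(1)] Q(2) by (auto simp: inj_on_def m subset_iff)
  then have "distinct (used m)" "length (used m) = min (2 * k) ?n"
    by (simp_all only: used_entry Qeq Q(3))
  ultimately show "\<exists>j\<le>length B. \<exists>m\<in>set (paths A B ?n j).
      k \<le> duos m \<and> distinct (used m) \<and> length (used m) = min (2 * k) ?n"
    using \<open>prev m \<le> length B\<close> by blast
next
  let ?n = "length A"
  have len: "length B = ?n" using assms[unfolded related_def, THEN mset_eq_length] by simp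
  assume "\<exists>j\<le>length B. \<exists>m\<in>set (paths A B ?n j).
      k \<le> duos m \<and> distinct (used m) \<and> length (used m) = min (2 * k) ?n"
  then obtain j m where j: "j \<le> length B" and mem: "m \<in> set (paths A B ?n j)"
    and kd: "k \<le> duos m" and dist: "distinct (used m)" by auto
  from mem have m: "length m = ?n" "set m \<subseteq> {..?n}"
    "\<And>p. p < ?n \<Longrightarrow> entry m p = 0 \<or> A ! p = B ! (entry m p - 1)"
    unfolding paths_iff[OF j] len by auto
  define Q where "Q = {p. p < ?n \<and> entry m p \<noteq> 0}"
  have "entry m p \<le> ?n" if "p < ?n" for p
    using nth_mem[of p "rev m"] that m(1,2) by (auto simp: entry_def)
  then have "(\<lambda>p. entry m p - 1) ` Q \<subseteq> {..<length B}" by (force simp: Q_def len)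
  moreover have "inj_on (\<lambda>p. entry m p - 1) Q"
    using dist unfolding used_entry m(1) by (auto simp: inj_on_def Q_def)
  moreover have "Q \<subseteq> {..<?n}" by (auto simp: Q_def)
  moreover have "A ! p = B ! (entry m p - 1)" if "p \<in> Q" for p
    using m(3)[of p] that by (simp add: Q_def)
  ultimately obtain f where f: "is_mapping A B f" "\<And>p. p \<in> Q \<Longrightarrow> f p = entry m p - 1"
    using extend_partial_mapping[OF assms, of Q "\<lambda>p. entry m p - 1"] by metis
  \<comment> \<open>Both ends of a duo of \<open>m\<close> lie in \<open>Q\<close>, where
    \<open>f\<close> agrees with \<open>m\<close>; the extension can only add further duos.\<close>
  have "duos m \<le> card (preserved_duos A f)"
    unfolding duos_entry
  proof (rule card_mono)
    show "finite (preserved_duos A f)"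
      by (rule finite_subset[of _ "{..<?n}"]) (auto simp: preserved_duos_def)
    show "{p. Suc p < length m \<and> 0 < entry m p \<and> entry m (Suc p) = Suc (entry m p)} \<subseteq>
        preserved_duos A f"
      by (auto simp: preserved_duos_def m(1) f(2) Q_def)
  qed
  with kd f(1) show "max_duo_psm A B k" unfolding max_duo_psm_def using le_trans by blast
qed

section \<open>The decision criterion\<close>

definition num_matched :: "nat \<Rightarrow> nat \<Rightarrow> nat" where "num_matched n k = min (2 * k) n"

text \<open>
  \<open>2 ^ gap n\<close> exceeds the number \<open>(n + 1) ^ n\<close> of paths times the largest squared minor, so that
  preserving one duo less cannot be made up for by many or heavy paths.
\<close>

definition gap :: "nat \<Rightarrow> nat" where "gap n = 5 * n * n * n + 1"

definition all_paths :: "nat list \<Rightarrow> nat list \<Rightarrow> nat \<Rightarrow> nat list list" where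
  "all_paths A B i = concat (map (paths A B i) [0..<Suc (length B)])"

text \<open>For each last value \<open>j\<close> the paths of length \<open>Suc i\<close> are either
  none or one per path of length \<open>i\<close>, so every position multiplies the count by at most
  \<open>Suc (length B)\<close>.\<close>

lemma length_all_paths: "length (all_paths A B i) \<le> Suc (length B) ^ i"
proof (induction i)
  case 0
  have "length (all_paths A B 0) = (\<Sum>j\<leftarrow>[0..<Suc (length B)]. if j = 0 then 1 else 0)"
    by (auto simp: all_paths_def length_concat o_def intro!: arg_cong[where f = sum_list])
  also have "\<dots> = 1" by (subst upt_conv_Cons) (auto simp: sum_list_0 map_idI cong: map_cong)
  finally show ?case by simp
next
  case (Suc i)
  have "length (paths A B (Suc i) j) \<le> length (all_paths A B i)" for j
    by (simp add: all_paths_def map_concat[symmetric] length_concat o_def del: upt_Suc)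
  then have "length (all_paths A B (Suc i)) \<le> (\<Sum>j\<leftarrow>[0..<Suc (length B)]. length (all_paths A B i))"
    unfolding all_paths_def[of A B "Suc i"] length_concat map_map o_def
    by (intro sum_list_mono) blast
  also have "\<dots> = Suc (length B) * length (all_paths A B i)"
    by (simp add: sum_list_triv del: upt_Suc)
  also have "\<dots> \<le> Suc (length B) ^ Suc i" unfolding power_Suc by (rule mult_le_mono2[OF Suc])
  finally show ?case .
qed

lemma Suc_le_exp: "Suc n \<le> 2 ^ n"
  by (induction n) auto

lemma sum_list_bound:
  "(\<And>x. x \<in> set xs \<Longrightarrow> f x \<le> (c::int)) \<Longrightarrow> (\<Sum>x\<leftarrow>xs. f x) \<le> int (length xs) * c"
  by (induction xs) (auto simp: algebra_simps add_mono)

text \<open>In \<open>abs_minor_le\<close> the factor \<open>d\<close> is at most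
  \<open>2 ^ n\<close>, and \<open>d\<close> in the exponents is at most \<open>n\<close>, which
  bounds the minor by \<open>2 ^ (n * n + n * n * n)\<close>; squaring doubles the exponent.\<close>

lemma minor_bound:
  assumes "d \<le> n" "set us \<subseteq> {..n}"
  shows "minor {..<d} us * minor {..<d} us \<le> 2 ^ (2 * n * n + 2 * n * n * n)"
proof (cases "minor {..<d} us = 0")
  case False
  then have len: "length us = d" by (simp add: minor_eq_0_iff)
  have "d \<le> 2 ^ n" using assms(1) Suc_le_exp[of n] by linarith
  from this[THEN zle_int[THEN iffD2]] have "int d \<le> 2 ^ n" by simp
  moreover have "(2::int) ^ (n * d) \<le> 2 ^ (n * n)" using assms(1) by (intro power_increasing) auto
  ultimately have "int d * 2 ^ (n * d) \<le> 2 ^ n * 2 ^ (n * n)" by (intro mult_mono) auto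
  then have "(int d * 2 ^ (n * d)) ^ d \<le> (2 ^ n * 2 ^ (n * n)) ^ d" by (intro power_mono) auto
  also have "\<dots> \<le> (2 ^ n * 2 ^ (n * n)) ^ n" using assms(1) by (intro power_increasing) (auto simp
      flip: power_add)
  also have "\<dots> = 2 ^ (n * n + n * n * n)" by (simp only: power_mult_distrib power_add
      power_mult[symmetric])
  finally have "(int d * 2 ^ (n * d)) ^ length us \<le> 2 ^ (n * n + n * n * n)" unfolding len .
  moreover have "\<bar>minor {..<d} us\<bar> \<le> (int d * 2 ^ (n * d)) ^ length us"
    using assms(2) by (intro abs_minor_le) auto
  ultimately have "\<bar>minor {..<d} us\<bar> \<le> 2 ^ (n * n + n * n * n)" by (rule order.trans[rotated])
  then have "\<bar>minor {..<d} us\<bar> * \<bar>minor {..<d} us\<bar> \<le> 2 ^ (n * n + n * n * n) * 2 ^ (n * n + n * n * n)"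
    by (intro mult_mono) auto
  also have "\<dots> = 2 ^ (2 * n * n + 2 * n * n * n)"
    by (simp only: power_add[symmetric]) (simp add: algebra_simps)
  finally show ?thesis by (simp only: abs_mult[symmetric] abs_mult_self_eq)
qed simp

text \<open>All weights are nonnegative. One good path reaches the threshold on its own, because a
  nonzero integer square is at least 1; without one, every nonzero weight lacks a factor
  \<open>2 ^ gap n\<close>, and all of them together stay below the threshold.\<close>

theorem max_duo_psm_iff_sum:
  fixes A B :: "nat list"
  assumes "related A B" "length A = n"
  shows "max_duo_psm A B k \<longleftrightarrow>
    2 ^ (gap n * k) \<le> (\<Sum>m\<leftarrow>all_paths A B n. weight (gap n) {..<num_matched n k} {..<num_matched n k} m)"
proof -
  let ?L = "gap n" and ?d = "num_matched n k"
  let ?w = "weight ?L {..<?d} {..<?d}"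
  have len: "length B = n" using assms(1)[unfolded related_def, THEN mset_eq_length] assms(2) by simp
  have mem: "m \<in> set (all_paths A B n) \<longleftrightarrow> (\<exists>j\<le>length B. m \<in> set (paths A B n j))" for m
    by (auto simp: all_paths_def less_Suc_eq_le simp del: upt_Suc)
  have psm: "max_duo_psm A B k \<longleftrightarrow>
      (\<exists>m\<in>set (all_paths A B n). k \<le> duos m \<and> minor {..<?d} (used m) \<noteq> 0)"
    unfolding max_duo_psm_iff_path[OF assms(1)] minor_eq_0_iff num_matched_def Bex_def mem
        assms(2) by meson
  have nonneg: "0 \<le> ?w m" for m by (simp add: weight_def mult.assoc)
  show ?thesis
  proof
    assume "max_duo_psm A B k"
    then obtain m where m: "m \<in> set (all_paths A B n)" "k \<le> duos m" "minor {..<?d} (used m) \<noteq> 0"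
      unfolding psm by blast
    have "0 < minor {..<?d} (used m) * minor {..<?d} (used m)" using m(3) by (auto simp:
        zero_less_mult_iff linorder_neq_iff)
    then have "1 \<le> minor {..<?d} (used m) * minor {..<?d} (used m)" by linarith
    moreover have "(2::int) ^ (?L * k) \<le> 2 ^ (?L * duos m)" using m(2) by (intro power_increasing) auto
    ultimately have "2 ^ (?L * k) * 1 \<le> ?w m" unfolding weight_def mult.assoc by (intro mult_mono) auto
    also have "?w m \<le> (\<Sum>m\<leftarrow>all_paths A B n. ?w m)"
      using m(1) nonneg by (intro member_le_sum_list) auto
    finally show "2 ^ (?L * k) \<le> (\<Sum>m\<leftarrow>all_paths A B n. ?w m)" by simp
  next
    assume le: "2 ^ (?L * k) \<le> (\<Sum>m\<leftarrow>all_paths A B n. ?w m)"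
    show "max_duo_psm A B k"
    proof (rule ccontr)
      assume neg: "\<not> max_duo_psm A B k"
      \<comment> \<open>Both sides are scaled by \<open>2 ^ ?L\<close>, which expresses the missing
        duo without subtracting in the exponent.\<close>
      have "?w m * 2 ^ ?L \<le> 2 ^ (?L * k) * 2 ^ (2 * n * n + 2 * n * n * n)"
        if m: "m \<in> set (all_paths A B n)" for m
      proof (cases "minor {..<?d} (used m) = 0")
        case False
        with neg m have "Suc (duos m) \<le> k" unfolding psm by force
        then have "(2::int) ^ (?L * duos m + ?L) \<le> 2 ^ (?L * k)"
          by (intro power_increasing) (use mult_le_mono2[of "Suc (duos m)" k ?L] in auto)
        moreover have "set (used m) \<subseteq> {..n}" using m unfolding mem
          by (auto simp: paths_iff used_def len)
        then have "minor {..<?d} (used m) * minor {..<?d} (used m) \<le> 2 ^ (2 * n * n + 2 * n * n * n)"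
          by (intro minor_bound) (simp_all add: num_matched_def)
        ultimately have "2 ^ (?L * duos m + ?L) * (minor {..<?d} (used m) * minor {..<?d} (used m))
            \<le> 2 ^ (?L * k) * 2 ^ (2 * n * n + 2 * n * n * n)" by (intro mult_mono) auto
        then show ?thesis by (simp add: weight_def power_add mult_ac)
      qed (simp add: weight_def)
      then have "(\<Sum>m\<leftarrow>all_paths A B n. ?w m * 2 ^ ?L)
          \<le> int (length (all_paths A B n)) * (2 ^ (?L * k) * 2 ^ (2 * n * n + 2 * n * n * n))"
        by (rule sum_list_bound)
      also have "\<dots> \<le> 2 ^ (n * n) * (2 ^ (?L * k) * 2 ^ (2 * n * n + 2 * n * n * n))"
      proof (rule mult_right_mono)
        have "length (all_paths A B n) \<le> (2 ^ n) ^ n"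
          using length_all_paths[of A B n] power_mono[OF Suc_le_exp[of n], of n] len by simp
        from this[THEN zle_int[THEN iffD2]] show "int (length (all_paths A B n)) \<le> 2 ^ (n * n)"
          by (simp add: power_mult)
      qed simp
      also have "\<dots> = 2 ^ (?L * k) * 2 ^ (3 * n * n + 2 * n * n * n)"
        by (simp only: power_add[symmetric] mult.assoc[symmetric])
          (simp add: algebra_simps)
      \<comment> \<open>The exponent collects \<open>n * n\<close> for the number of paths and
        \<open>2 * n * n + 2 * n * n * n\<close> for the squared minors;
        \<open>n * n \<le> n * (n * n)\<close> brings it below \<open>gap n\<close>.\<close>
      also have "\<dots> < 2 ^ (?L * k) * 2 ^ ?L"
      proof -
        have "n * n \<le> n * (n * n)" by (cases "n = 0") auto
        then have "3 * (n * n) + 2 * (n * (n * n)) < 5 * (n * (n * n)) + 1" by linarith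
        then have "3 * n * n + 2 * n * n * n < ?L" by (simp only: gap_def mult.assoc)
        then show ?thesis by simp
      qed
      finally have "(\<Sum>m\<leftarrow>all_paths A B n. ?w m) * 2 ^ ?L < 2 ^ (?L * k) * 2 ^ ?L"
        by (simp add: sum_list_mult_const)
      with le show False by simp
    qed
  qed
qed

text \<open>Moving the negative part to the left yields an inequality between natural numbers, which
  the machine can decide. The mask \<open>2 ^ num_matched n k - 1\<close> stands for the full set of
  exponents.\<close>

corollary max_duo_psm_iff_table:
  fixes A B :: "nat list"
  assumes "related A B" "length A = n"
  shows "max_duo_psm A B k \<longleftrightarrow>
    (\<Sum>j<Suc n. table A B (gap n) (num_matched n k) n j (2 ^ num_matched n k - 1) (2 ^ num_matched
        n k - 1) 1) + 2 ^ (gap n * k)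
     \<le> (\<Sum>j<Suc n. table A B (gap n) (num_matched n k) n j (2 ^ num_matched n k - 1) (2 ^
         num_matched n k - 1) 0)"
proof -
  let ?d = "num_matched n k" let ?F = "2 ^ ?d - 1 :: nat"
  let ?T = "\<lambda>j s. table A B (gap n) ?d n j ?F ?F s"
  have len: "length B = n" using assms(1)[unfolded related_def, THEN mset_eq_length] assms(2) by simp
  have "(\<Sum>m\<leftarrow>all_paths A B n. weight (gap n) {..<?d} {..<?d} m)
      = (\<Sum>j<Suc n. \<Sum>m\<leftarrow>paths A B n j. weight (gap n) {..<?d} {..<?d} m)"
    by (simp add: all_paths_def sum_list_concat map_concat o_def len interv_sum_list_conv_sum_set_nat
        atLeast0LessThan del: upt_Suc sum.lessThan_Suc)
  also have "\<dots> = (\<Sum>j<Suc n. int (?T j 0) - int (?T j 1))"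
    by (intro sum.cong refl) (simp only: table_diff[of ?F ?d ?F] bits_full diff_less zero_less_one
        zero_less_power zero_less_numeral)
  also have "\<dots> = int (\<Sum>j<Suc n. ?T j 0) - int (\<Sum>j<Suc n. ?T j 1)"
    by (simp only: sum_subtractf of_nat_sum)
  finally have eq: "(\<Sum>m\<leftarrow>all_paths A B n. weight (gap n) {..<?d} {..<?d} m)
     = int (\<Sum>j<Suc n. ?T j 0) - int (\<Sum>j<Suc n. ?T j 1)" .
  have "(2::int) ^ e \<le> int a - int b \<longleftrightarrow> b + 2 ^ e \<le> a" for e a b
  proof -
    have "b + 2 ^ e \<le> a \<longleftrightarrow> int (b + 2 ^ e) \<le> int a" by (simp only: of_nat_le_iff)
    then show ?thesis unfolding of_nat_add of_nat_power of_nat_numeral by linarith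
  qed
  then show ?thesis unfolding max_duo_psm_iff_sum[OF assms] eq .
qed

section \<open>The program\<close>

abbreviation var :: "string \<Rightarrow> tm" where "var x \<equiv> Arr x (Num 0)"

definition tmod :: "tm \<Rightarrow> tm \<Rightarrow> tm" where
  "tmod a b = Bin Sub a (Bin Mul (Bin Div a b) b)"

definition tbit :: "tm \<Rightarrow> tm \<Rightarrow> tm" where
  "tbit t a = tmod (Bin Div t (Bin Shl (Num 1) a)) (Num 2)"

definition tlow :: "string \<Rightarrow> tm \<Rightarrow> tm" where
  "tlow z a = Sum ''c'' a (tbit (var z) (var ''c''))"

definition teq :: "tm \<Rightarrow> tm \<Rightarrow> tm \<Rightarrow> tm \<Rightarrow> tm" where
  "teq a b t u = Ite (Bin Add (Bin Sub a b) (Bin Sub b a)) u t"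

text \<open>Mixed-radix address with \<open>i\<close> as the leading digit, so that row
  \<open>i\<close> lies entirely behind row \<open>i - 1\<close> and the table can be filled in
  address order.\<close>

definition index :: "nat \<Rightarrow> nat \<Rightarrow> nat \<Rightarrow> nat \<Rightarrow> nat \<Rightarrow> nat \<Rightarrow> nat \<Rightarrow> nat" where
  "index N R i j I J s = (((i * N + j) * R + I) * R + J) * 2 + s"

definition tindex :: "tm \<Rightarrow> tm \<Rightarrow> tm \<Rightarrow> tm \<Rightarrow> tm \<Rightarrow> tm" where
  "tindex i j I J s = Bin Add (Bin Mul (Bin Add (Bin Mul (Bin Add (Bin Mul (Bin Add (Bin Mul i
      (var ''N'')) j)
     (var ''R'')) I) (var ''R'')) J) (Num 2)) s"

lemma puts_result_append: "puts_result (ps @ qs) s = puts_result qs (puts_result ps s)"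
  by (induction ps arbitrary: s) (simp_all del: fun_upd_apply split: prod.split add: split_paired_all)

lemma puts_bounded_append:
  "puts_bounded W (ps @ qs) s \<longleftrightarrow> puts_bounded W ps s \<and> puts_bounded W qs (puts_result ps s)"
  by (induction ps arbitrary: s) (simp_all del: fun_upd_apply split: prod.split add: split_paired_all)

lemma eval_tmod [simp]: "eval (tmod a b) s = eval a s mod eval b s"
  by (simp add: tmod_def minus_div_mult_eq_mod)

lemma eval_tbit [simp]: "eval (tbit t a) s = of_bool (bit (eval t s) (eval a s))"
  by (simp add: tbit_def bit_iff_odd mod_2_eq_odd)

lemma eval_tlow [simp]: "z \<noteq> ''c'' \<Longrightarrow> eval (tlow z a) s = low_bits (s z 0) (eval a s)"
  by (simp add: tlow_def low_bits_def)

lemma eval_teq [simp]: "eval (teq a b t u) s = (if eval a s = eval b s then eval t s else eval u s)"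
  by (auto simp: teq_def)

lemma eval_tindex [simp]: "eval (tindex i j I J t) s
    = index (s ''N'' 0) (s ''R'' 0) (eval i s) (eval j s) (eval I s) (eval J s) (eval t s)"
  by (simp add: tindex_def index_def)

lemma bounded_tmod [simp]: "bounded_iters W (tmod a b) s \<longleftrightarrow>
    bounded_iters W a s \<and> bounded_iters W b s \<and> eval a s \<le> W \<and> eval b s \<le> W"
  by (auto simp: tmod_def)

lemma bounded_tbit [simp]: "bounded_iters W (tbit t a) s \<longleftrightarrow>
    bounded_iters W t s \<and> bounded_iters W a s \<and> eval t s \<le> W \<and> eval a s \<le> W \<and> 2 \<le> W"
  using order.trans[OF div_le_dividend[of "eval t s" "2 ^ eval a s"], of W] by (auto simp: tbit_def)

lemma bounded_tlow:
  assumes "bounded_iters W a s" "eval a s \<le> W" "s z 0 \<le> W" "2 \<le> W" "z \<noteq> ''c''"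
  shows "bounded_iters W (tlow z a) s"
  using assms by (auto simp: tlow_def)

lemma bounded_teq [simp]: "bounded_iters W (teq a b t u) s \<longleftrightarrow> bounded_iters W a s \<and> bounded_iters W b s \<and>
    (if eval a s = eval b s then bounded_iters W t s else bounded_iters W u s)"
  by (auto simp: teq_def)

lemma bounded_tindex [simp]: "bounded_iters W (tindex i j I J t) s \<longleftrightarrow>
    bounded_iters W i s \<and> bounded_iters W j s \<and> bounded_iters W I s \<and> bounded_iters W J s \<and>
    bounded_iters W t s \<and> s ''N'' 0 \<le> W \<and> s ''R'' 0 \<le> W \<and> 2 \<le> W"
  by (auto simp: tindex_def)

lemma stackless_macros [simp]:
  "stackless (tmod a b) \<longleftrightarrow> stackless a \<and> stackless b"
  "stackless (tbit t a) \<longleftrightarrow> stackless t \<and> stackless a"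
  "stackless (tlow z a) \<longleftrightarrow> z \<noteq> stack \<and> stackless a"
  "stackless (teq a b t u) \<longleftrightarrow> stackless a \<and> stackless b \<and> stackless t \<and> stackless u"
  "stackless (tindex i j I J u) \<longleftrightarrow> stackless i \<and> stackless j \<and> stackless I \<and> stackless J \<and> stackless u"
  by (auto simp: tmod_def tbit_def tlow_def teq_def tindex_def)

text \<open>The recursion of \<open>table\<close>, with the previous row read from \<open>M\<close>.
  In row 0 all other digits vanish exactly if the address \<open>q\<close> is 0, so a single test
  decides the base case.\<close>

definition entry_tm :: tm where
  "entry_tm = (let prev_i = Bin Sub (var ''i'') (Num 1) in
     teq (var ''i'') (Num 0) (teq (var ''q'') (Num 0) (Num 1) (Num 0))
     (teq (var ''j'') (Num 0)
        (Sum ''x'' (var ''N'') (Arr ''M'' (tindex prev_i (var ''x'') (var ''I'') (var ''J'') (var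
            ''s''))))
     (teq (Arr ''A'' prev_i) (Arr ''B'' (Bin Sub (var ''j'') (Num 1)))
        (Sum ''x'' (var ''N'') (Sum ''a'' (var ''d'') (Sum ''b'' (var ''d'')
           (Ite (tbit (var ''I'') (var ''a'')) (Ite (tbit (var ''J'') (var ''b''))
              (Bin Shl
                 (Arr ''M'' (tindex prev_i (var ''x'')
                    (Bin Sub (var ''I'') (Bin Shl (Num 1) (var ''a'')))
                    (Bin Sub (var ''J'') (Bin Shl (Num 1) (var ''b'')))
                    (tmod (Bin Add (Bin Add (var ''s'') (tlow ''I'' (var ''a''))) (tlow ''J'' (var
                        ''b''))) (Num 2))))
                 (Bin Add (Bin Mul (var ''j'') (Bin Add (var ''a'') (var ''b'')))
                    (Ite (var ''x'') (teq (var ''j'') (Bin Add (var ''x'') (Num 1)) (var ''L'')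
                        (Num 0)) (Num 0))))
              (Num 0)) (Num 0)))))
        (Num 0))))"

text \<open>\<open>T\<close> is the address of the first cell of row \<open>n + 1\<close>, that is,
  the number of cells in the rows 0 to \<open>n\<close>. The minimum in \<open>d\<close> is a test
  of the truncated difference \<open>n - 2 * k\<close>.\<close>

definition prepare :: "(string \<times> tm \<times> tm) list" where
  "prepare =
     [(''d'', Num 0, Ite (Bin Sub (var ''n'') (Bin Add (var ''k'') (var ''k''))) (Bin Add (var
         ''k'') (var ''k'')) (var ''n'')),
      (''R'', Num 0, Bin Shl (Num 1) (var ''d'')),
      (''N'', Num 0, Bin Add (var ''n'') (Num 1)),
      (''L'', Num 0, Bin Add (Bin Mul (Bin Mul (Bin Mul (Num 5) (var ''n'')) (var ''n'')) (var
          ''n'')) (Num 1)),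
      (''T'', Num 0, tindex (var ''N'') (Num 0) (Num 0) (Num 0) (Num 0))]"

definition decode :: "(string \<times> tm \<times> tm) list" where
  "decode = (let q2 = Bin Div (var ''q'') (Num 2); qR = Bin Div q2 (var ''R''); qRR = Bin Div qR
      (var ''R'') in
     [(''s'', Num 0, tmod (var ''q'') (Num 2)),
      (''J'', Num 0, tmod q2 (var ''R'')),
      (''I'', Num 0, tmod qR (var ''R'')),
      (''j'', Num 0, tmod qRR (var ''N'')),
      (''i'', Num 0, Bin Div qRR (var ''N''))])"

definition fill_cell :: "(string \<times> tm \<times> tm) list" where
  "fill_cell = decode @
     [(''M'', var ''q'', entry_tm),
      (''q'', Num 0, Bin Add (var ''q'') (Num 1))]"

definition decide :: "(string \<times> tm \<times> tm) list" where
  "decide = (let F = Bin Sub (var ''R'') (Num 1);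
       total = (\<lambda>t. Sum ''x'' (var ''N'') (Arr ''M'' (tindex (var ''n'') (var ''x'') F F (Num t)))) in
     [(''result'', Num 0, Ite (Bin Sub (Bin Add (total 1) (Bin Shl (Num 1) (Bin Mul (var ''L'')
         (var ''k'')))) (total 0))
         (Num 0) (Num 1))])"

definition program :: com where
  "program = Seq (puts prepare)
     (Seq (While (Less (Cell ''q'' (Const 0)) (Cell ''T'' (Const 0))) (puts fill_cell)) (puts decide))"

lemma stackless_program:
  "puts_stackless prepare" "puts_stackless fill_cell" "puts_stackless decide"
  by (simp_all add: prepare_def decode_def fill_cell_def decide_def entry_tm_def Let_def)

section \<open>Mixed-radix addresses of table cells\<close>

lemma index_components:
  assumes "j < N" "I < R" "J < R" "s < 2" "q = index N R i j I J s"
  shows "q mod 2 = s" "q div 2 mod R = J" "q div 2 div R mod R = I"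
    "q div 2 div R div R mod N = j" "q div 2 div R div R div N = i"
proof -
  have *: "(x * b + r) div b = x" "(x * b + r) mod b = r" if "r < b" for x b r :: nat
    using that by auto
  have "q div 2 = ((i * N + j) * R + I) * R + J" "q mod 2 = s"
    unfolding assms(5) index_def using *[OF assms(4)] by blast+
  moreover from this have "q div 2 div R = (i * N + j) * R + I" "q div 2 mod R = J"
    using *[OF assms(3)] by simp_all
  moreover from this have "q div 2 div R div R = i * N + j" "q div 2 div R mod R = I"
    using *[OF assms(2)] by simp_all
  ultimately show "q mod 2 = s" "q div 2 mod R = J" "q div 2 div R mod R = I"
    "q div 2 div R div R mod N = j" "q div 2 div R div R div N = i"
    using *[OF assms(1)] by simp_all
qed

lemma index_recompose:
  "q = index N R (q div 2 div R div R div N) (q div 2 div R div R mod N) (q div 2 div R mod R)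
     (q div 2 mod R) (q mod 2)"
  by (simp add: index_def)

text \<open>Dividing off the four lower digits leaves exactly \<open>i\<close> on the left and at
  least \<open>i'\<close> on the right, where the lower digits may exceed their radix.\<close>

lemma index_less:
  assumes "j < N" "I < R" "J < R" "s < 2" "i < i'"
  shows "index N R i j I J s < index N R i' j' I' J' s'"
proof -
  have "index N R i j I J s div 2 div R div R div N = i"
    using index_components(5)[OF assms(1-4) refl] .
  moreover have "i' \<le> index N R i' j' I' J' s' div 2 div R div R div N"
  proof -
    have *: "x \<le> y div b" if "x * b \<le> y" "0 < b" for x y b :: nat
      using div_le_mono[OF that(1), of b] that(2) by simp
    have "((i' * N + j') * R + I') * R + J' \<le> index N R i' j' I' J' s' div 2"
      by (rule *) (simp_all add: index_def)
    then have "(i' * N + j') * R + I' \<le> index N R i' j' I' J' s' div 2 div R"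
      by (rule *[OF add_leD1]) (use assms(2) in linarith)
    then have "i' * N + j' \<le> index N R i' j' I' J' s' div 2 div R div R"
      by (rule *[OF add_leD1]) (use assms(2) in linarith)
    then show ?thesis
      by (rule *[OF add_leD1]) (use assms(1) in linarith)
  qed
  ultimately show ?thesis
    using assms(5) div_le_mono[OF div_le_mono[OF div_le_mono[OF div_le_mono]],
        of "index N R i' j' I' J' s'" "index N R i j I J s" 2 R R N]
    by linarith
qed

section \<open>Invariant and loop bounds of the table computation\<close>

definition loaded :: "nat list \<Rightarrow> nat list \<Rightarrow> nat \<Rightarrow> nat \<Rightarrow> memory \<Rightarrow> bool" where
  "loaded A B n k s \<longleftrightarrow> s ''A'' = array_of A \<and> s ''B'' = array_of B \<and> s ''n'' 0 = n \<and> s ''k'' 0 = k \<and>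
     s ''d'' 0 = num_matched n k \<and> s ''R'' 0 = 2 ^ num_matched n k \<and> s ''N'' 0 = Suc n \<and> s ''L'' 0
         = gap n \<and>
     s ''T'' 0 = index (Suc n) (2 ^ num_matched n k) (Suc n) 0 0 0 0"

definition cell_value :: "nat list \<Rightarrow> nat list \<Rightarrow> nat \<Rightarrow> nat \<Rightarrow> nat \<Rightarrow> nat" where
  "cell_value A B n k q = (let R = 2 ^ num_matched n k in
     table A B (gap n) (num_matched n k) (q div 2 div R div R div Suc n) (q div 2 div R div R mod Suc n)
       (q div 2 div R mod R) (q div 2 mod R) (q mod 2))"

lemma cell_value_index:
  assumes "j \<le> n" "I < 2 ^ num_matched n k" "J < 2 ^ num_matched n k" "s < 2"
  shows "cell_value A B n k (index (Suc n) (2 ^ num_matched n k) i j I J s) = table A B (gap n)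
      (num_matched n k) i j I J s"
  unfolding cell_value_def Let_def
  by (simp only: index_components[OF le_imp_less_Suc[OF assms(1)] assms(2-4) refl])

text \<open>By \<open>index_less\<close> every cell read while computing row \<open>i\<close> lies
  in row \<open>i - 1\<close> and below the address \<open>q\<close>, where the table is already
  correct.\<close>

lemma eval_entry:
  assumes "loaded A B n k s" "length A = n" "length B = n" and q: "s ''q'' 0 = q"
    and comp: "s ''i'' 0 = i" "s ''j'' 0 = j" "s ''I'' 0 = I" "s ''J'' 0 = J" "s ''s'' 0 = \<sigma>"
    and ran: "i \<le> n" "j \<le> n" "I < 2 ^ num_matched n k" "J < 2 ^ num_matched n k" "\<sigma> < 2"
    and idx: "q = index (Suc n) (2 ^ num_matched n k) i j I J \<sigma>"
    and filled: "\<And>q'. q' < q \<Longrightarrow> s ''M'' q' = cell_value A B n k q'"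
  shows "eval entry_tm s = table A B (gap n) (num_matched n k) i j I J \<sigma>"
proof (cases i)
  case 0
  have "q = 0 \<longleftrightarrow> j = 0 \<and> I = 0 \<and> J = 0 \<and> \<sigma> = 0" unfolding idx 0 by (auto simp: index_def)
  then show ?thesis by (simp add: 0 entry_tm_def Let_def comp q)
next
  case (Suc i')
  note ld = assms(1)[unfolded loaded_def]
  have rd: "s ''M'' (index (Suc n) (2 ^ num_matched n k) i' j' I' J' t) = table A B (gap n)
      (num_matched n k) i' j' I' J' t"
    if "j' \<le> n" "I' < 2 ^ num_matched n k" "J' < 2 ^ num_matched n k" "t < 2" for j' I' J' t
    using that unfolding cell_value_index[OF that, symmetric]
    by (intro filled) (auto simp: idx Suc intro!: index_less)
  have lt: "I - 2 ^ a < 2 ^ num_matched n k" "J - 2 ^ a < 2 ^ num_matched n k" for a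
    using ran by (auto intro: le_less_trans[OF diff_le_self])
  have AB: "array_of A i' = A ! i'" "j \<noteq> 0 \<Longrightarrow> array_of B (j - 1) = B ! (j - 1)"
    using ran Suc assms(2,3) by (auto simp: array_of_def)
  show ?thesis
  proof (cases "j \<noteq> 0 \<and> A ! i' = B ! (j - 1)")
    case True
    show ?thesis
      using True AB
      by (simp add: Suc entry_tm_def Let_def comp q ld del: sum.lessThan_Suc)
        (intro sum.cong refl, simp_all add: Suc comp ld rd lt assms(3) less_Suc_eq_le)
  next
    case False
    then show ?thesis using AB
      by (auto simp add: Suc entry_tm_def Let_def comp q ld simp del: sum.lessThan_Suc)
        (auto simp: Suc comp ld rd ran assms(3) less_Suc_eq_le simp del: sum.lessThan_Suc intro!:
            sum.cong)
  qed
qed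

text \<open>In order: the number of table cells, sums of indices and parities, shift distances
  within a cell, the shift distance of the final threshold, the multiplier in that distance, and the
  number of masks.\<close>

definition iters_ok :: "nat \<Rightarrow> nat \<Rightarrow> nat \<Rightarrow> bool" where
  "iters_ok n k W \<longleftrightarrow> index (Suc n) (2 ^ num_matched n k) (Suc n) 0 0 0 0 \<le> W \<and> 2 * n + 2 \<le> W \<and>
     n * (2 * n) + gap n \<le> W \<and> gap n * k \<le> W \<and> k \<le> W \<and> 2 ^ num_matched n k \<le> W"

lemma low_bits_le: "low_bits I a \<le> a"
proof -
  have "low_bits I a \<le> (\<Sum>c<a. 1)" unfolding low_bits_def by (rule sum_mono) simp
  then show ?thesis by simp
qed

text \<open>Table entries enter only as summands and as left operands of shifts, whose iterations do
  not depend on their size; every other quantity is a small index, a mask or an exponent of at most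
  \<open>n * (2 * n) + gap n\<close>.\<close>

lemma bounded_entry:
  assumes "loaded A B n k s" "iters_ok n k W"
    and ran: "s ''j'' 0 \<le> n" "s ''I'' 0 < 2 ^ num_matched n k" "s ''J'' 0 < 2 ^ num_matched n k"
        "s ''s'' 0 < 2"
  shows "bounded_iters W entry_tm s"
proof -
  note ld = assms(1)[unfolded loaded_def]
  have W: "2 \<le> W" "Suc n \<le> W" "2 ^ num_matched n k \<le> W" and d: "num_matched n k \<le> n" "num_matched
      n k \<le> W"
    using assms(2) by (auto simp: iters_ok_def num_matched_def)
  have IJ: "s ''I'' 0 \<le> W" "s ''J'' 0 \<le> W" using ran W by linarith+
  have ab: "a \<le> W" "s ''s'' 0 + low_bits I a + low_bits J b \<le> W" "a + b \<le> W"
    "s ''j'' 0 * (a + b) + (if c then gap n else 0) \<le> W"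
    if "a < num_matched n k" "b < num_matched n k" for a b I J c
  proof -
    show "a \<le> W" using that d by linarith
    have "a + b \<le> 2 * n" using that d by linarith
    then have "s ''j'' 0 * (a + b) \<le> n * (2 * n)" using ran by (intro mult_le_mono)
    then show "s ''j'' 0 * (a + b) + (if c then gap n else 0) \<le> W" using assms(2) by (auto simp:
        iters_ok_def)
    show "a + b \<le> W" "s ''s'' 0 + low_bits I a + low_bits J b \<le> W"
      using \<open>a + b \<le> 2 * n\<close> low_bits_le[of I a] low_bits_le[of J b] ran assms(2)
      by (auto simp: iters_ok_def)
  qed
  have ex: "x * (a + b) + gap n \<le> W" "x * (a + b) \<le> W"
    if "a < num_matched n k" "b < num_matched n k" "s ''j'' 0 = x" for a b x
    using ab(4)[OF that(1,2), of True] ab(4)[OF that(1,2), of False] that(3) by simp_all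
  show ?thesis
    by (auto simp: entry_tm_def Let_def ld W d IJ ab ex simp del: mult_Suc intro!: bounded_tlow)
qed

lemma decode_result:
  assumes "loaded A B n k s" "iters_ok n k W" and q: "s ''q'' 0 = q" "q \<le> W"
  defines "s' \<equiv> puts_result decode s" and "R \<equiv> 2 ^ num_matched n k"
  shows "puts_bounded W decode s" "loaded A B n k s'" "s' ''q'' = s ''q''" "s' ''M'' = s ''M''"
    "s' ''s'' 0 = q mod 2" "s' ''J'' 0 = q div 2 mod R" "s' ''I'' 0 = q div 2 div R mod R"
    "s' ''j'' 0 = q div 2 div R div R mod Suc n" "s' ''i'' 0 = q div 2 div R div R div Suc n"
proof -
  note ld = assms(1)[unfolded loaded_def]
  have W: "2 \<le> W" "Suc n \<le> W" "2 ^ num_matched n k \<le> W"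
    using assms(2) by (auto simp: iters_ok_def num_matched_def)
  have d: "q div 2 \<le> W" "q div 2 div R \<le> W" "q div 2 div R div R \<le> W"
    using q(2) by (meson div_le_dividend le_trans)+
  show "puts_bounded W decode s"
    using d unfolding R_def by (simp add: decode_def Let_def ld W q)
  show "loaded A B n k s'" "s' ''q'' = s ''q''" "s' ''M'' = s ''M''"
    "s' ''s'' 0 = q mod 2" "s' ''J'' 0 = q div 2 mod R" "s' ''I'' 0 = q div 2 div R mod R"
    "s' ''j'' 0 = q div 2 div R div R mod Suc n" "s' ''i'' 0 = q div 2 div R div R div Suc n"
    unfolding s'_def R_def by (simp_all add: decode_def Let_def loaded_def ld q)
qed

definition filled :: "nat list \<Rightarrow> nat list \<Rightarrow> nat \<Rightarrow> nat \<Rightarrow> nat \<Rightarrow> memory \<Rightarrow> bool" where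
  "filled A B n k q s \<longleftrightarrow> loaded A B n k s \<and> s ''q'' 0 = q \<and> (\<forall>q'<q. s ''M'' q' = cell_value A B n k q')"

text \<open>The lower digits of \<open>q\<close> are in range as remainders; the bound on
  \<open>q\<close> serves to keep the leading digit \<open>?i\<close> at most
  \<open>n\<close>.\<close>

lemma fill_step:
  assumes "filled A B n k q s" "iters_ok n k W" and len: "length A = n" "length B = n"
    and q: "q < index (Suc n) (2 ^ num_matched n k) (Suc n) 0 0 0 0"
  shows "puts_bounded W fill_cell s" "filled A B n k (Suc q) (puts_result fill_cell s)"
proof -
  let ?R = "2 ^ num_matched n k :: nat" and ?s = "puts_result decode s"
  let ?\<sigma> = "q mod 2" and ?J = "q div 2 mod ?R" and ?I = "q div 2 div ?R mod ?R"
    and ?j = "q div 2 div ?R div ?R mod Suc n" and ?i = "q div 2 div ?R div ?R div Suc n"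
  have qW: "q \<le> W" using assms(2) q by (simp add: iters_ok_def)
  note dec = decode_result[OF _ assms(2) _ qW, of A B s]
  have ld: "loaded A B n k s" and sq: "s ''q'' 0 = q" and M: "\<forall>q'<q. s ''M'' q' = cell_value A B n k q'"
    using assms(1) by (simp_all add: filled_def)
  note dec = decode_result[OF ld assms(2) sq qW]
  have "q < Suc n * Suc n * ?R * ?R * 2" using q by (simp add: index_def)
  then have "?i < Suc n" by (intro less_mult_imp_div_less)
  then have i: "?i \<le> n" by simp
  have j: "?j \<le> n" using mod_less_divisor[of "Suc n"] less_Suc_eq_le by blast
  have IJ: "?I < ?R" "?J < ?R" "?\<sigma> < 2" by simp_all
  have ev: "eval entry_tm ?s = cell_value A B n k q"
    using eval_entry[OF dec(2) len _ dec(9,8,7,6,5) i j IJ index_recompose] dec(3,4) M sq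
    by (simp add: cell_value_def Let_def)
  have be: "bounded_iters W entry_tm ?s"
    by (rule bounded_entry[OF dec(2) assms(2)]) (simp_all only: dec j IJ)
  show "puts_bounded W fill_cell s"
    unfolding fill_cell_def puts_bounded_append using dec(1) be by simp
  show "filled A B n k (Suc q) (puts_result fill_cell s)"
    unfolding fill_cell_def puts_result_append using dec(2) ev sq M
    by (auto simp: filled_def loaded_def dec(3,4) less_Suc_eq)
qed

definition total_time :: "nat \<Rightarrow> nat" where
  "total_time W = puts_time W prepare + (W * (puts_time W fill_cell + 6) + 6 + puts_time W decide)"

lemma prepare_result:
  assumes "length A = n" "length B = n" "iters_ok n k W"
  shows "puts_bounded W prepare (psm_input A B k)"
    "filled A B n k 0 (puts_result prepare (psm_input A B k))"
proof -
  have W: "2 \<le> W" "n \<le> W" "Suc n \<le> W" "2 ^ num_matched n k \<le> W" "num_matched n k \<le> W"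
    using assms(3) by (auto simp: iters_ok_def num_matched_def)
  have d: "n \<le> k + k \<Longrightarrow> num_matched n k = n" "\<not> n \<le> k + k \<Longrightarrow> num_matched n k = k + k" by (simp_all
      add: num_matched_def)
  then have W': "n \<le> k + k \<Longrightarrow> 2 ^ n \<le> W" "\<not> n \<le> k + k \<Longrightarrow> 2 ^ (k + k) \<le> W"
    using W(4) by simp_all
  have inp: "psm_input A B k ''n'' 0 = n" "psm_input A B k ''k'' 0 = k"
    "psm_input A B k ''A'' = array_of A" "psm_input A B k ''B'' = array_of B" "psm_input A B k
        ''q'' 0 = 0"
    using assms(1) by (simp_all add: psm_input_def array_of_def)
  show "puts_bounded W prepare (psm_input A B k)"
    using W W' by (simp add: prepare_def inp)
  show "filled A B n k 0 (puts_result prepare (psm_input A B k))"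
    by (simp add: filled_def loaded_def prepare_def inp gap_def d)
qed

lemma decide_result:
  assumes "related A B" "length A = n" "iters_ok n k W"
    and "filled A B n k (index (Suc n) (2 ^ num_matched n k) (Suc n) 0 0 0 0) s"
  shows "puts_bounded W decide s" "accepts (puts_result decide s) \<longleftrightarrow> max_duo_psm A B k"
proof -
  have ld: "loaded A B n k s" using assms(4) by (simp add: filled_def)
  note ld' = ld[unfolded loaded_def]
  let ?F = "2 ^ num_matched n k - 1 :: nat"
  have rd: "s ''M'' (index (Suc n) (2 ^ num_matched n k) n j ?F ?F t) = table A B (gap n)
      (num_matched n k) n j ?F ?F t"
    if "j < Suc n" "t < 2" for j t
  proof -
    have "index (Suc n) (2 ^ num_matched n k) n j ?F ?F t < index (Suc n) (2 ^ num_matched n k)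
        (Suc n) 0 0 0 0"
      using that by (intro index_less) simp_all
    with assms(4) have "s ''M'' (index (Suc n) (2 ^ num_matched n k) n j ?F ?F t)
        = cell_value A B n k (index (Suc n) (2 ^ num_matched n k) n j ?F ?F t)" by (simp add:
            filled_def)
    also have "\<dots> = table A B (gap n) (num_matched n k) n j ?F ?F t"
      using that by (intro cell_value_index) simp_all
    finally show ?thesis .
  qed
  have W: "2 \<le> W" "Suc n \<le> W" "2 ^ num_matched n k \<le> W" "gap n * k \<le> W" "k \<le> W"
    using assms(3) by (auto simp: iters_ok_def)
  show "puts_bounded W decide s"
    using W by (simp add: decide_def Let_def ld' del: sum.lessThan_Suc)
  have tot: "eval (Sum ''x'' (var ''N'') (Arr ''M'' (tindex (var ''n'') (var ''x'')
        (Bin Sub (var ''R'') (Num 1)) (Bin Sub (var ''R'') (Num 1)) (Num t)))) s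
      = (\<Sum>j<Suc n. table A B (gap n) (num_matched n k) n j ?F ?F t)" if "t < 2" for t
    using rd[OF _ that] by (simp add: ld' del: sum.lessThan_Suc)
  show "accepts (puts_result decide s) \<longleftrightarrow> max_duo_psm A B k"
    unfolding max_duo_psm_iff_table[OF assms(1,2)]
    using tot[of 0] tot[of 1]
    by (simp add: decide_def Let_def accepts_def ld' del: sum.lessThan_Suc)
qed

lemma runs_program:
  assumes "related A B" "length A = n" "length B = n" "iters_ok n k W"
  shows "runs program (psm_input A B k) (total_time W) (\<lambda>s. accepts s \<longleftrightarrow> max_duo_psm A B k)"
proof -
  let ?T = "index (Suc n) (2 ^ num_matched n k) (Suc n) 0 0 0 0" and ?s = "psm_input A B k"
  let ?b = "Less (Cell ''q'' (Const 0)) (Cell ''T'' (Const 0))"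
  let ?Q = "\<lambda>i s'. \<exists>s g. s' = with_stack s g \<and> filled A B n k i s"
  have T: "?T \<le> W" using assms(4) by (simp add: iters_ok_def)
  have 1: "runs (puts prepare) ?s (puts_time W prepare) (?Q 0)"
  proof -
    note pr = prepare_result[OF assms(2-4)]
    have "runs (puts prepare) (with_stack ?s (?s stack)) (puts_time W prepare) (?Q 0)"
      by (rule runs_mono[OF runs_puts[OF stackless_program(1) pr(1)] order_refl]) (use pr(2) in blast)
    then show ?thesis by (simp only: with_stack_id)
  qed
  have 2: "runs (While ?b (puts fill_cell)) s (W * (puts_time W fill_cell + 6) + 6) (?Q ?T)"
    if "?Q 0 s" for s
  proof -
    have "runs (While ?b (puts fill_cell)) s (?T * (puts_time W fill_cell + 1 + bcost ?b) + 1 +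
        bcost ?b) (?Q ?T)"
    proof (rule runs_while)
      fix i s' assume i: "i < ?T" and "?Q i s'"
      then obtain s g where s: "s' = with_stack s g" "filled A B n k i s" by blast
      note st = fill_step[OF s(2) assms(4,2,3) i]
      show "runs (puts fill_cell) s' (puts_time W fill_cell) (?Q (Suc i))"
        unfolding s(1)
        by (rule runs_mono[OF runs_puts[OF stackless_program(2) st(1)] order_refl]) (use st(2) in blast)
    next
      fix i s' assume "i \<le> ?T" and "?Q i s'"
      then show "bval ?b s' \<longleftrightarrow> i < ?T" by (auto simp: filled_def loaded_def)
    qed (use that in blast)
    moreover have "?T * (puts_time W fill_cell + 1 + bcost ?b) + 1 + bcost ?b
        \<le> W * (puts_time W fill_cell + 6) + 6"
    proof -
      have "puts_time W fill_cell + 1 + bcost ?b = puts_time W fill_cell + 6" "bcost ?b = 5" by simp_all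
      then show ?thesis using mult_le_mono1[OF T, of "puts_time W fill_cell + 6"] by (simp only:)
    qed
    ultimately show ?thesis by (rule runs_mono)
  qed
  have 3: "runs (puts decide) s' (puts_time W decide) (\<lambda>s. accepts s \<longleftrightarrow> max_duo_psm A B k)"
    if "?Q ?T s'" for s'
  proof -
    from that obtain s g where s: "s' = with_stack s g" "filled A B n k ?T s" by blast
    note dr = decide_result[OF assms(1,2,4) s(2)]
    show ?thesis unfolding s(1)
      by (rule runs_mono[OF runs_puts[OF stackless_program(3) dr(1)] order_refl])
        (use dr(2) in \<open>auto simp: accepts_def\<close>)
  qed
  have 23: "runs (Seq (While ?b (puts fill_cell)) (puts decide)) s
      (W * (puts_time W fill_cell + 6) + 6 + puts_time W decide) (\<lambda>s. accepts s \<longleftrightarrow> max_duo_psm A B k)"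
    if "?Q 0 s" for s
    by (rule runs_seq[OF runs_mono[OF 2[OF that] order_refl 3]]) simp_all
  show ?thesis unfolding program_def total_time_def
    by (rule runs_seq[OF runs_mono[OF 1 order_refl 23]]) simp_all
qed

section \<open>Asymptotic running time\<close>

lemma poly_bounded_total_time: "poly_bounded total_time"
  unfolding total_time_def[abs_def]
  by (intro poly_bounded_add poly_bounded_mult poly_bounded_const poly_bounded_id
      poly_bounded_puts_time)

text \<open>The table has \<open>2 * (n + 1) ^ 2 * (R * R)\<close> cells for
  \<open>R = 2 ^ num_matched n k\<close>, and \<open>R \<le> 4 ^ k\<close> because at most
  \<open>2 * k\<close> positions are matched; this contributes \<open>16 ^ k \<le> 32 ^ k\<close>.
  The factors depending on \<open>n\<close> alone are at most
  \<open>12 * (n + 1) ^ 3\<close>.\<close>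

lemma iters_ok_bound: "iters_ok n k (12 * (n + 1) ^ 3 * 32 ^ k)"
proof -
  let ?X = "(n + 1) ^ 3" and ?Y = "32 ^ k :: nat"
  have bound: "a * b \<le> 12 * ?X * ?Y" if "a \<le> 12 * ?X" "b \<le> ?Y" for a b
    using that by (intro mult_le_mono)
  have X: "1 \<le> ?X" "2 * (n + 1) ^ 2 \<le> 12 * ?X" "2 * n + 2 \<le> 12 * ?X"
    "n * (2 * n) + gap n \<le> 12 * ?X" "gap n \<le> 12 * ?X"
    by (simp_all add: gap_def power3_eq_cube power2_eq_square algebra_simps)
  have k: "k \<le> ?Y" using less_exp[of k] power_mono[of 2 "32::nat" k] by simp
  have R: "2 ^ num_matched n k \<le> (4::nat) ^ k"
  proof -
    have "(2::nat) ^ num_matched n k \<le> 2 ^ (2 * k)" by (intro power_increasing) (simp_all add: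
        num_matched_def)
    then show ?thesis by (simp add: power_mult)
  qed
  have "(4::nat) ^ k * 4 ^ k \<le> ?Y" by (simp add: power_mono flip: power_mult_distrib)
  then have RR: "2 ^ num_matched n k * 2 ^ num_matched n k \<le> ?Y" using mult_le_mono[OF R R] by linarith
  have R1: "2 ^ num_matched n k \<le> ?Y" using R power_mono[of 4 "32::nat" k] by simp
  have "index (Suc n) r (Suc n) 0 0 0 0 = 2 * (n + 1) ^ 2 * (r * r)" for r
    by (simp add: index_def power2_eq_square algebra_simps)
  then show ?thesis
    unfolding iters_ok_def
    using bound[OF X(2) RR] bound[OF X(3), of 1] bound[OF X(4), of 1] bound[OF X(5) k]
      bound[of 1, OF _ k] bound[of 1, OF _ R1] X(1) by simp
qed

theorem theorem1:
  "\<exists>(P :: com) (f :: nat \<Rightarrow> real) (g :: nat \<Rightarrow> real) (p :: real poly).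
     f \<in> O(\<lambda>k. real k) \<and>
     g \<in> O(\<lambda>n. poly p (real n) * ln (real n)) \<and>
     (\<forall>(A :: nat list) (B :: nat list) (n :: nat) (k :: nat).
        related A B \<longrightarrow> length A = n \<longrightarrow> length B = n \<longrightarrow>
        (\<exists>t s. exec P (psm_input A B k) t s \<and>
               (accepts s \<longleftrightarrow> max_duo_psm A B k) \<and>
               real t \<le> 2 powr f k * g n))"
proof -
  obtain c where c: "\<And>W. total_time W \<le> (W + 2) ^ c"
    using poly_bounded_total_time unfolding poly_bounded_def by blast
  \<comment> \<open>The factor 5 comes from \<open>32 = 2 ^ 5\<close>, so that
    \<open>(32 ^ k) ^ c = 2 powr f k\<close>.\<close>
  define f where "f k = 5 * real c * real k" for k :: nat
  \<comment> \<open>The 14 arises from \<open>12 * x + 2 \<le> 14 * x\<close> with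
    \<open>x = (n + 1) ^ 3 * 32 ^ k \<ge> 1\<close>.\<close>
  define p :: "real poly" where "p = [:14 ^ c:] * [:1, 1:] ^ (3 * c)"
  define g where "g n = poly p (real n)" for n
  have g: "g n = 14 ^ c * (real n + 1) ^ (3 * c)" for n by (simp add: g_def p_def add.commute)
  have "f \<in> O(\<lambda>k. real k)" unfolding f_def[abs_def] by simp
  \<comment> \<open>\<open>g\<close> itself is a plain polynomial, so the time bound also holds at
    \<open>n = 1\<close>, where \<open>ln\<close> vanishes; asymptotically the logarithm only helps,
    being at least 1 from \<open>n = 3\<close> on.\<close>
  moreover have "g \<in> O(\<lambda>n. poly p (real n) * ln (real n))"
  proof (rule bigoI[where c = 1], rule eventually_sequentiallyI[of 3])
    fix n :: nat assume "3 \<le> n"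
    then have "exp 1 \<le> real n" using exp_le by linarith
    then have "1 \<le> ln (real n)" using \<open>3 \<le> n\<close> by (subst ln_ge_iff) auto
    then show "norm (g n) \<le> 1 * norm (poly p (real n) * ln (real n))"
      using mult_left_mono[of 1 "\<bar>ln (real n)\<bar>" "\<bar>g n\<bar>"] by (simp add: abs_mult g_def)
  qed
  moreover have "\<exists>t s. exec program (psm_input A B k) t s \<and> (accepts s \<longleftrightarrow> max_duo_psm A B k) \<and>
      real t \<le> 2 powr f k * g n"
    if AB: "related A B" "length A = n" "length B = n" for A B n k
  proof -
    let ?W = "12 * (n + 1) ^ 3 * 32 ^ k"
    from runs_program[OF AB iters_ok_bound] obtain t s where ts:
      "exec program (psm_input A B k) t s" "t \<le> total_time ?W" "accepts s \<longleftrightarrow> max_duo_psm A B k"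
      unfolding runs_def by blast
    have "?W + 2 \<le> 14 * (n + 1) ^ 3 * 32 ^ k" by simp
    then have "t \<le> (14 * (n + 1) ^ 3 * 32 ^ k) ^ c"
      using ts(2) c[of ?W] power_mono[of "?W + 2" "14 * (n + 1) ^ 3 * 32 ^ k" c] by linarith
    then have "real t \<le> real ((14 * (n + 1) ^ 3 * 32 ^ k) ^ c)" by (simp only: of_nat_le_iff)
    also have "\<dots> = 32 ^ (k * c) * g n"
      by (simp add: g power_mult_distrib power_mult add.commute)
    also have "(32::real) ^ (k * c) = 2 powr f k"
    proof -
      have "(32::real) ^ (k * c) = 2 ^ (5 * (k * c))" by (simp add: power_mult)
      also have "\<dots> = 2 powr real (5 * (k * c))" by (rule powr_realpow[symmetric]) simp
      finally show ?thesis by (simp add: f_def mult_ac)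
    qed
    finally show ?thesis using ts by blast
  qed
  ultimately show ?thesis by blast
qed

end
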